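(* Let $n\ge2$, $p\in\mathbb{N}$ and $\bm j=(j_0,\dots,j_p)\in\mathcal{J}^n_p$ with $0<j_0,\dots,j_p<n$. For any $K\in\mathcal{K}(\mathbb{R}^n)$ one has $$W_{p,K}(\bm j)\leq\frac{(n!)^p}{(np)!}\,\frac{n^n}{j_0^{j_0}\cdots j_p^{j_p}}\,|K|^p.$$
   Context: $\mathcal{K}(\mathbb{R}^n)$ denotes the set of convex bodies, i.e. nonempty compact convex subsets of $\mathbb{R}^n$; $|\cdot|$ is Lebesgue measure (in the dimension of the ambient space). The mixed volume of $K_1,\dots,K_N\in\mathcal{K}(\mathbb{R}^N)$ is $V(K_1,\dots,K_N)=\frac1{N!}\frac{\partial^N}{\partial s_1\cdots\partial s_N}\big|_{s_1=\dots=s_N=0}|s_1K_1+\dots+s_NK_N|$ (Minkowski sums; the volume is a homogeneous polynomial of degree $N$ in $s_1,\dots,s_N\ge0$). $L[k]$ means that $L$ is repeated $k$ times. Identify $\mathbb{R}^{pn}=(\mathbb{R}^n)^p$; $\Delta_p(x)=(x,\dots,x)$ is the diagonal embedding $\mathbb{R}^n\to\mathbb{R}^{pn}$ and $\iota_i:\mathbb{R}^n\to\mathbb{R}^{pn}$, $1\le i\le p$, the inclusion into the $i$-th factor. $\mathcal{J}_p^n=\{\bm j=(j_0,\dots,j_p)\in\mathbb{N}_0^{p+1}:j_0+\dots+j_p=n\}$; $W_{p,K}(\bm j)=V\big(-\Delta_pK[n-j_0],\iota_1K[n-j_1],\dots,\iota_pK[n-j_p]\big)$. *)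

theory Defs
  imports "HOL-Analysis.Analysis"
begin

definition convex_body :: "'a::euclidean_space set \<Rightarrow> bool" where
  "convex_body K \<longleftrightarrow> K \<noteq> {} \<and> compact K \<and> convex K"

(* Set_Algebras supplies the Minkowski sum as addition of sets. *)
definition volume_combination :: "'a::euclidean_space set list \<Rightarrow> (nat \<Rightarrow> real) \<Rightarrow> real" where
  "volume_combination Ks s = measure lebesgue (\<Sum>i<length Ks. (\<lambda>x. s i *\<^sub>R x) ` (Ks ! i))"

(* The volume of a Minkowski combination is a polynomial in the coefficients only where these are
   nonnegative, so every partial derivative is taken within the half-line {0..}; at the origin it
   is one-sided, and equals the derivative of that polynomial. *)
definition partial_deriv :: "nat \<Rightarrow> ((nat \<Rightarrow> real) \<Rightarrow> real) \<Rightarrow> (nat \<Rightarrow> real) \<Rightarrow> real" where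
  "partial_deriv i f s = vector_derivative (\<lambda>t. f (s(i := t))) (at (s i) within {0..})"

(* Meaningful for length Ks = DIM('a) only. *)
definition mixed_volume :: "'a::euclidean_space set list \<Rightarrow> real" where
  "mixed_volume Ks =
     1 / fact (length Ks) * foldr partial_deriv [0..<length Ks] (volume_combination Ks) (\<lambda>_. 0)"

(* R^(pn) is the type (real^'n)^'p with p = CARD('p) and n = CARD('n); the index type 'p is
   linearly ordered so that the p factors can be listed from first to last. *)

definition diag_emb :: "real^'n \<Rightarrow> (real^'n)^'p" where
  "diag_emb x = (\<chi> i. x)"

definition factor_incl :: "'p \<Rightarrow> real^'n \<Rightarrow> (real^'n)^'p" where
  "factor_incl i x = axis i x"

(* A tuple (j_0, ..., j_p) is a function on 'p option: j_0 is the value at None, and the remaining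
   entries are the values at Some i. *)
definition index_tuples :: "nat \<Rightarrow> ('p::finite option \<Rightarrow> nat) set" where
  "index_tuples n = {j. (\<Sum>a\<in>UNIV. j a) = n}"

definition W :: "(real^'n) set \<Rightarrow> ('p::{finite,linorder} option \<Rightarrow> nat) \<Rightarrow> real" where
  "W K j = mixed_volume
     (replicate (CARD('n) - j None) (uminus ` diag_emb ` K) @
      concat (map (\<lambda>i. replicate (CARD('n) - j (Some i)) (factor_incl i ` K))
                  (sorted_list_of_set (UNIV :: 'p set))))"

end

theory Submission
  imports Defs "HOL-Probability.Distributions"
begin

text \<open>
  Polynomiality. For finite sets \<open>V\<^sub>a\<close> the map \<open>x \<mapsto> \<Sum>\<^sub>a s\<^sub>a \<nabla>(ln \<Sum>\<^bsub>v\<in>V\<^sub>a\<^esub> exp \<langle>x, v\<rangle>)\<close> is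
  injective with image the interior of \<open>\<Sum>\<^sub>a s\<^sub>a conv V\<^sub>a\<close>, up to a null set. Its Jacobian is a combination
  of rank one matrices, so by the Cauchy--Binet expansion the volume is a polynomial in \<open>s\<close> with
  nonnegative coefficients; approximation extends this to arbitrary convex bodies.

  Inequality. Let \<open>P(s)\<close> be the volume of \<open>- s\<^sub>0 \<Delta> K + \<Sum>\<^sub>i s\<^sub>i \<iota>\<^sub>i K\<close> and let \<open>G(z)\<close> be the volume of
  \<open>s\<^sub>0 K \<inter> \<Inter>\<^sub>i (s\<^sub>i K - z\<^sub>i)\<close>, whose integral is \<open>|K|\<close> to the power \<open>p + 1\<close> times the product of all \<open>s\<^sub>a\<close> to the
  power \<open>n\<close>. If \<open>z\<close> lies in the body with parameters \<open>s\<^sub>a - r\<close>, then the intersection contains a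
  translate of \<open>r K\<close>, so integrating \<open>G\<close> gives
  \<open>\<integral>\<^sub>0\<^bsup>min s\<^esup> n r\<^bsup>n-1\<^esup> P(s - r) dr \<le> |K|\<^sup>p \<Prod>\<^sub>a s\<^sub>a\<^sup>n\<close>. Keep the single monomial of \<open>P\<close> with exponents
  \<open>n - j\<^sub>a\<close> and integrate against \<open>exp (- \<Sum>\<^sub>a j\<^sub>a s\<^sub>a)\<close>: all integrals are Gamma integrals, and the
  weights \<open>j\<^sub>a\<close> are the optimal choice.
\<close>

section \<open>Determinants of sums of rank one matrices and log-sum-exp functions\<close>

lemma det_rows_sum:
  fixes a :: "'m::finite \<Rightarrow> 'k \<Rightarrow> real^'m"
  assumes "finite X"
  shows "det (\<chi> i. \<Sum>k\<in>X. a i k) = (\<Sum>\<phi>\<in>{\<phi>. \<forall>i. \<phi> i \<in> X}. det (\<chi> i. a i (\<phi> i)))"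
proof -
  have "(\<Prod>i\<in>UNIV. \<Sum>k\<in>X. a i k $ p i) = (\<Sum>\<phi>\<in>{\<phi>. \<forall>i. \<phi> i \<in> X}. \<Prod>i\<in>UNIV. a i (\<phi> i) $ p i)" for p
    using prod_sum_PiE[of "UNIV :: 'm set" "\<lambda>_. X" "\<lambda>i k. a i k $ p i"] assms
    by (simp add: PiE_UNIV_domain Pi_def)
  then have "det (\<chi> i. \<Sum>k\<in>X. a i k) = (\<Sum>p | p permutes UNIV. \<Sum>\<phi>\<in>{\<phi>. \<forall>i. \<phi> i \<in> X}.
      of_int (sign p) * (\<Prod>i\<in>UNIV. a i (\<phi> i) $ p i))"
    by (simp add: det_def sum_distrib_left)
  then show ?thesis
    by (subst (asm) sum.swap) (simp add: det_def)
qed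

text \<open>Cauchy-Binet with the sum over all maps \<phi> instead of index subsets: every set of
  \<open>CARD('m)\<close> indices is met once per ordering, whence the factorial, and maps that are
  not injective give equal rows and determinant 0. The squares show that nonnegative
  \<open>b\<close> give a nonnegative determinant.\<close>

lemma det_sum_rank_one:
  fixes u :: "'k \<Rightarrow> real^'m" and b :: "'k \<Rightarrow> real"
  assumes "finite X"
  shows "det (\<chi> i j. \<Sum>k\<in>X. b k * (u k $ i * u k $ j)) =
    (\<Sum>\<phi>\<in>{\<phi>. \<forall>i. \<phi> i \<in> X}. (\<Prod>i\<in>UNIV. b (\<phi> i)) * (det (\<chi> i. u (\<phi> i)))\<^sup>2) / fact CARD('m)"
proof -
  let ?F = "{\<phi>::'m \<Rightarrow> 'k. \<forall>i. \<phi> i \<in> X}"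
  let ?P = "{\<pi>::'m \<Rightarrow> 'm. \<pi> permutes UNIV}"
  define D where "D \<phi> = det (\<chi> i. u (\<phi> i))" for \<phi> :: "'m \<Rightarrow> 'k"
  define g where "g \<phi> = (\<Prod>i\<in>UNIV. b (\<phi> i)) * (\<Prod>i\<in>UNIV. u (\<phi> i) $ i) * D \<phi>" for \<phi>
  have rows: "(\<chi> i j. \<Sum>k\<in>X. b k * (u k $ i * u k $ j)) = (\<chi> i. \<Sum>k\<in>X. (b k * u k $ i) *s u k)"
    by (simp add: vec_eq_iff mult.assoc)
  have 1: "det (\<chi> i j. \<Sum>k\<in>X. b k * (u k $ i * u k $ j)) = (\<Sum>\<phi>\<in>?F. g \<phi>)"
    unfolding rows det_rows_sum[OF assms] det_rows_mul g_def D_def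
    by (simp add: prod.distrib)
  \<comment> \<open>Averaging the sum over all rearrangements \<^term>\<open>\<phi> \<circ> \<pi>\<close> turns each summand into a square.\<close>
  have 2: "(\<Sum>\<phi>\<in>?F. g \<phi>) = (\<Sum>\<phi>\<in>?F. (\<Prod>i\<in>UNIV. b (\<phi> i)) * D \<phi> *
      (of_int (sign \<pi>) * (\<Prod>i\<in>UNIV. u (\<phi> (\<pi> i)) $ i)))" if p: "\<pi> permutes UNIV" for \<pi>
  proof -
    have bij: "bij \<pi>" using p permutes_bij by blast
    have "(\<Sum>\<phi>\<in>?F. g \<phi>) = (\<Sum>\<phi>\<in>?F. g (\<phi> \<circ> \<pi>))"
      using bij
      by (intro sum.reindex_bij_witness[of _ "\<lambda>\<phi>. \<phi> \<circ> \<pi>" "\<lambda>\<phi>. \<phi> \<circ> inv \<pi>"])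
         (auto simp: comp_assoc bij_is_inj bij_is_surj surj_f_inv_f fun_eq_iff)
    moreover have "g (\<phi> \<circ> \<pi>) = (\<Prod>i\<in>UNIV. b (\<phi> i)) * D \<phi> *
      (of_int (sign \<pi>) * (\<Prod>i\<in>UNIV. u (\<phi> (\<pi> i)) $ i))" for \<phi>
    proof -
      have "D (\<phi> \<circ> \<pi>) = of_int (sign \<pi>) * D \<phi>"
        using det_permute_rows[OF p, of "\<chi> i. u (\<phi> i)"] by (simp add: D_def)
      moreover have "(\<Prod>i\<in>UNIV. b ((\<phi> \<circ> \<pi>) i)) = (\<Prod>i\<in>UNIV. b (\<phi> i))"
        using prod.permute[OF p, of "\<lambda>i. b (\<phi> i)"] by (simp add: o_def)
      ultimately show ?thesis by (simp add: g_def)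
    qed
    ultimately show ?thesis by simp
  qed
  have D: "(\<Sum>\<pi>\<in>?P. of_int (sign \<pi>) * (\<Prod>i\<in>UNIV. u (\<phi> (\<pi> i)) $ i)) = D \<phi>" for \<phi>
    unfolding D_def by (subst det_transpose[symmetric]) (simp add: det_def transpose_def)
  have "fact CARD('m) * (\<Sum>\<phi>\<in>?F. g \<phi>) = (\<Sum>\<pi>\<in>?P. \<Sum>\<phi>\<in>?F. g \<phi>)"
    by (simp add: card_permutations[OF refl])
  also have "\<dots> = (\<Sum>\<pi>\<in>?P. \<Sum>\<phi>\<in>?F. (\<Prod>i\<in>UNIV. b (\<phi> i)) * D \<phi> *
      (of_int (sign \<pi>) * (\<Prod>i\<in>UNIV. u (\<phi> (\<pi> i)) $ i)))"
    by (rule sum.cong[OF refl], rule 2) simp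
  also have "\<dots> = (\<Sum>\<phi>\<in>?F. (\<Prod>i\<in>UNIV. b (\<phi> i)) * (D \<phi>)\<^sup>2)"
    by (subst sum.swap) (simp add: sum_distrib_left[symmetric] D power2_eq_square mult.assoc)
  finally show ?thesis
    unfolding 1 D_def by (simp add: field_simps)
qed

section \<open>Calculus and convexity of log-sum-exp functions\<close>

definition expsum :: "'a::real_inner set \<Rightarrow> 'a \<Rightarrow> real" where
  "expsum V x = (\<Sum>v\<in>V. exp (x \<bullet> v))"

definition gibbs :: "'a::real_inner set \<Rightarrow> 'a \<Rightarrow> 'a \<Rightarrow> real" where
  "gibbs V x v = exp (x \<bullet> v) / expsum V x"

text \<open>This is the gradient of \<open>ln (expsum V)\<close>, a smooth upper bound for the
  support function of \<open>convex hull V\<close>.\<close>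

definition gibbs_mean :: "'a::real_inner set \<Rightarrow> 'a \<Rightarrow> 'a" where
  "gibbs_mean V x = (\<Sum>v\<in>V. gibbs V x v *\<^sub>R v)"

lemma expsum_pos: "finite V \<Longrightarrow> V \<noteq> {} \<Longrightarrow> 0 < expsum V x"
  unfolding expsum_def by (intro sum_pos) auto

lemma gibbs_pos: "finite V \<Longrightarrow> V \<noteq> {} \<Longrightarrow> 0 < gibbs V x v"
  by (simp add: gibbs_def expsum_pos)

lemma sum_gibbs: "finite V \<Longrightarrow> V \<noteq> {} \<Longrightarrow> (\<Sum>v\<in>V. gibbs V x v) = 1"
  using expsum_pos[of V x] by (simp add: gibbs_def sum_divide_distrib[symmetric] expsum_def[symmetric])

lemma gibbs_mean_in_hull: "finite V \<Longrightarrow> V \<noteq> {} \<Longrightarrow> gibbs_mean V x \<in> convex hull V"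
  unfolding gibbs_mean_def
  by (intro convex_sum) (auto simp: sum_gibbs gibbs_pos less_imp_le hull_inc)

text \<open>For \<open>v\<close> in \<open>V\<close> the sum contains the positive term
  \<open>exp (x \<bullet> v)\<close>; the inequality describes a half-space, so it passes from
  \<open>V\<close> to the hull.\<close>

lemma inner_le_ln_expsum:
  assumes "finite V" "V \<noteq> {}" "q \<in> convex hull V"
  shows "x \<bullet> q \<le> ln (expsum V x)"
proof -
  have "V \<subseteq> {y. x \<bullet> y \<le> ln (expsum V x)}"
  proof safe
    fix v assume "v \<in> V"
    then have "exp (x \<bullet> v) \<le> expsum V x"
      unfolding expsum_def by (intro member_le_sum) (auto simp: assms)
    then show "x \<bullet> v \<le> ln (expsum V x)"
      using expsum_pos[OF assms(1,2), of x] by (metis exp_gt_zero ln_exp ln_le_cancel_iff)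
  qed
  then have "convex hull V \<subseteq> {y. x \<bullet> y \<le> ln (expsum V x)}"
    by (intro hull_minimal) (auto intro: convex_halfspace_le)
  with assms show ?thesis by auto
qed

lemma has_derivative_expsum:
  "(expsum V has_derivative (\<lambda>h. \<Sum>v\<in>V. exp (x \<bullet> v) * (h \<bullet> v))) (at x within S)"
  unfolding expsum_def[abs_def]
  by (auto intro!: derivative_eq_intros sum.cong)

lemma has_derivative_ln_expsum:
  assumes "finite V" "V \<noteq> {}"
  shows "((\<lambda>x. ln (expsum V x)) has_derivative (\<lambda>h. h \<bullet> gibbs_mean V x)) (at x within S)"
proof -
  have "((\<lambda>x. ln (expsum V x)) has_derivative
      (\<lambda>h. (\<Sum>v\<in>V. exp (x \<bullet> v) * (h \<bullet> v)) * inverse (expsum V x))) (at x within S)"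
    by (rule has_derivative_ln[OF expsum_pos[OF assms] has_derivative_expsum])
  moreover have "(\<Sum>v\<in>V. exp (x \<bullet> v) * (h \<bullet> v)) * inverse (expsum V x) = h \<bullet> gibbs_mean V x" for h
    by (simp add: gibbs_mean_def gibbs_def inner_sum_right sum_distrib_left divide_inverse mult.commute mult.left_commute)
  ultimately show ?thesis by simp
qed

text \<open>The derivative is the covariance of the Gibbs weights. Centred vectors display it as a
  nonnegative combination of rank one maps, the shape that \<open>det_sum_rank_one\<close>
  expects.\<close>

lemma has_derivative_gibbs_mean:
  fixes V :: "'a::euclidean_space set"
  assumes "finite V" "V \<noteq> {}"
  shows "(gibbs_mean V has_derivative
     (\<lambda>h. \<Sum>v\<in>V. (gibbs V x v * ((v - gibbs_mean V x) \<bullet> h)) *\<^sub>R (v - gibbs_mean V x))) (at x within S)"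
proof -
  let ?m = "gibbs_mean V x"
  have Z: "0 < expsum V x" using expsum_pos[OF assms] .
  have w: "((\<lambda>x. gibbs V x v) has_derivative (\<lambda>h. gibbs V x v * ((v - ?m) \<bullet> h))) (at x within S)" for v
  proof -
    have "((\<lambda>x. exp (x \<bullet> v - ln (expsum V x))) has_derivative
        (\<lambda>h. exp (x \<bullet> v - ln (expsum V x)) * (h \<bullet> v - h \<bullet> ?m))) (at x within S)"
      by (rule derivative_eq_intros has_derivative_ln_expsum[OF assms] refl)+ (simp add: algebra_simps)
    moreover have "exp (x \<bullet> v - ln (expsum V x)) = gibbs V x v" for x
      using expsum_pos[OF assms, of x] by (simp add: gibbs_def exp_diff)
    moreover have "h \<bullet> v - h \<bullet> ?m = (v - ?m) \<bullet> h" for h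
      by (simp add: inner_diff_left inner_diff_right inner_commute)
    ultimately show ?thesis by simp
  qed
  \<comment> \<open>The centred vectors have Gibbs mean zero, so the outer vector \<open>v\<close>
    may be replaced by \<open>v - ?m\<close>.\<close>
  have zero: "(\<Sum>v\<in>V. gibbs V x v * ((v - ?m) \<bullet> h)) = 0" for h
    using sum_gibbs[OF assms, of x]
    by (simp add: inner_diff_left right_diff_distrib sum_subtractf flip: sum_distrib_right)
       (simp add: gibbs_mean_def inner_sum_left)
  have "((\<lambda>x. \<Sum>v\<in>V. gibbs V x v *\<^sub>R v) has_derivative
      (\<lambda>h. \<Sum>v\<in>V. (gibbs V x v * ((v - ?m) \<bullet> h)) *\<^sub>R v)) (at x within S)"
    by (auto intro!: derivative_eq_intros w)
  moreover have "(\<Sum>v\<in>V. (gibbs V x v * ((v - ?m) \<bullet> h)) *\<^sub>R v) =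
      (\<Sum>v\<in>V. (gibbs V x v * ((v - ?m) \<bullet> h)) *\<^sub>R (v - ?m))" for h
    by (simp add: scaleR_diff_right sum_subtractf zero flip: scaleR_sum_left)
  ultimately show ?thesis unfolding gibbs_mean_def[abs_def] by (simp add: gibbs_mean_def)
qed

lemma exp_gt_add_one:
  fixes t :: real
  assumes "t \<noteq> 0"
  shows "1 + t < exp t"
\<comment> \<open>Squaring \<open>1 + t / 2\<close> needs it nonnegative; for \<open>t\<close> below
  -2 the left side is negative anyway.\<close>
proof (cases "t < -2")
  case True
  then show ?thesis by (smt (verit) exp_gt_zero)
next
  case False
  have "1 + t < (1 + t / 2)\<^sup>2"
    using assms zero_less_power2[of t] by (simp add: power2_eq_square algebra_simps)
  also have "\<dots> \<le> (exp (t / 2))\<^sup>2"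
    using False exp_ge_add_one_self[of "t / 2"] by (intro power_mono) auto
  also have "\<dots> = exp t"
    by (simp flip: exp_double)
  finally show ?thesis .
qed

text \<open>Convexity by Jensen: \<open>expsum V y\<close> is \<open>expsum V x * exp ?m\<close>
  times the Gibbs mean of \<open>exp (t v)\<close>, where \<open>t\<close> has Gibbs mean 0, and
  \<open>exp t\<close> is at least \<open>1 + t\<close>, strictly for nonzero
  \<open>t\<close>.\<close>

lemma ln_expsum_above_tangent:
  assumes "finite V" "V \<noteq> {}"
  shows "ln (expsum V x) + (y - x) \<bullet> gibbs_mean V x \<le> ln (expsum V y)"
    and "v \<in> V \<Longrightarrow> (y - x) \<bullet> v \<noteq> (y - x) \<bullet> gibbs_mean V x \<Longrightarrow>
      ln (expsum V x) + (y - x) \<bullet> gibbs_mean V x < ln (expsum V y)"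
proof -
  let ?m = "(y - x) \<bullet> gibbs_mean V x"
  define t where "t v = (y - x) \<bullet> v - ?m" for v
  have Z: "0 < expsum V x" "0 < expsum V y" using expsum_pos[OF assms] by auto
  have "expsum V y = (\<Sum>v\<in>V. expsum V x * exp ?m * (gibbs V x v * exp (t v)))"
    unfolding expsum_def[of V y] using Z
    by (intro sum.cong) (auto simp: gibbs_def t_def inner_diff_left simp flip: exp_add)
  then have eq: "expsum V y = expsum V x * exp ?m * (\<Sum>v\<in>V. gibbs V x v * exp (t v))"
    by (simp add: sum_distrib_left)
  have one: "(\<Sum>v\<in>V. gibbs V x v * (1 + t v)) = 1"
    using sum_gibbs[OF assms, of x]
    by (simp add: t_def algebra_simps sum.distrib sum_subtractf flip: sum_distrib_right)
       (simp add: gibbs_mean_def inner_sum_right sum_distrib_left sum_subtractf algebra_simps)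
  have exp_ln: "exp (ln (expsum V x) + ?m) = expsum V x * exp ?m"
    using Z by (simp add: exp_add)
  have le: "gibbs V x v * (1 + t v) \<le> gibbs V x v * exp (t v)" for v
    using gibbs_pos[OF assms, of x v] exp_ge_add_one_self[of "t v"] by simp
  have "(\<Sum>v\<in>V. gibbs V x v * (1 + t v)) \<le> (\<Sum>v\<in>V. gibbs V x v * exp (t v))"
    by (intro sum_mono le)
  then have "exp (ln (expsum V x) + ?m) \<le> expsum V y"
    unfolding exp_ln eq one using Z by simp
  then show "ln (expsum V x) + ?m \<le> ln (expsum V y)"
    by (metis exp_gt_zero ln_exp ln_mono Z(2))
  assume v: "v \<in> V" "(y - x) \<bullet> v \<noteq> ?m"
  have "1 + t v < exp (t v)"
    using v by (intro exp_gt_add_one) (simp add: t_def)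
  then have "(\<Sum>v\<in>V. gibbs V x v * (1 + t v)) < (\<Sum>v\<in>V. gibbs V x v * exp (t v))"
    using v assms gibbs_pos[OF assms, of x v]
    by (intro sum_strict_mono_ex1) (auto simp: le intro!: bexI[of _ v] mult_strict_left_mono)
  then have "exp (ln (expsum V x) + ?m) < expsum V y"
    unfolding exp_ln eq one using Z by simp
  then show "ln (expsum V x) + ?m < ln (expsum V y)"
    by (metis exp_gt_zero ln_exp ln_less_cancel_iff Z(2))
qed

section \<open>Volumes of Minkowski combinations of polytopes\<close>

text \<open>Bodies are indexed by a finite type with one parameter per body, not by a list as in
  \<open>volume_combination\<close>; repeated list entries are merged in
  \<open>mixed_volume_map\<close>. The set-builder form gives direct access to the chosen
  points.\<close>

definition minkowski :: "('i::finite \<Rightarrow> 'a::real_vector set) \<Rightarrow> ('i \<Rightarrow> real) \<Rightarrow> 'a set" where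
  "minkowski K s = {\<Sum>a\<in>UNIV. s a *\<^sub>R q a | q. \<forall>a. q a \<in> K a}"

lemma minkowski_eq_sum: "minkowski K s = (\<Sum>a\<in>UNIV. (\<lambda>x. s a *\<^sub>R x) ` K a)"
proof -
  have "(\<Sum>a\<in>UNIV. (\<lambda>x. s a *\<^sub>R x) ` K a) = {\<Sum>a\<in>UNIV. r a | r. \<forall>a. r a \<in> (\<lambda>x. s a *\<^sub>R x) ` K a}"
    by (subst set_sum_alt) auto
  also have "\<dots> = minkowski K s"
    unfolding minkowski_def
  proof (intro subset_antisym subsetI)
    fix z assume "z \<in> {\<Sum>a\<in>UNIV. r a | r. \<forall>a. r a \<in> (\<lambda>x. s a *\<^sub>R x) ` K a}"
    then obtain r where z: "z = (\<Sum>a\<in>UNIV. r a)" and "\<forall>a. \<exists>x. x \<in> K a \<and> r a = s a *\<^sub>R x"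
      by (auto simp: image_iff Bex_def)
    then obtain q where "\<forall>a. q a \<in> K a \<and> r a = s a *\<^sub>R q a" by metis
    with z show "z \<in> {\<Sum>a\<in>UNIV. s a *\<^sub>R q a | q. \<forall>a. q a \<in> K a}" by auto
  next
    fix z assume "z \<in> {\<Sum>a\<in>UNIV. s a *\<^sub>R q a | q. \<forall>a. q a \<in> K a}"
    then obtain q where "\<forall>a. q a \<in> K a" "z = (\<Sum>a\<in>UNIV. s a *\<^sub>R q a)" by auto
    then show "z \<in> {\<Sum>a\<in>UNIV. r a | r. \<forall>a. r a \<in> (\<lambda>x. s a *\<^sub>R x) ` K a}"
      by (intro CollectI exI[of _ "\<lambda>a. s a *\<^sub>R q a"]) auto
  qed
  finally show ?thesis ..
qed

lemma convex_minkowski: "(\<And>a. convex (K a)) \<Longrightarrow> convex (minkowski K s)"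
  unfolding minkowski_eq_sum by (intro convex_set_sum convex_scaling)

lemma compact_set_sum:
  fixes A :: "'i \<Rightarrow> 'a::real_normed_vector set"
  assumes "\<And>i. i \<in> I \<Longrightarrow> compact (A i)"
  shows "compact (\<Sum>i\<in>I. A i)"
  using assms
proof (induction I rule: infinite_finite_induct)
  case (insert i I)
  moreover have "X + Y = {x + y | x y. x \<in> X \<and> y \<in> Y}" for X Y :: "'a set"
    by (auto simp: set_plus_def)
  ultimately show ?case by (simp add: compact_sums)
qed auto

lemma compact_minkowski:
  fixes K :: "'i::finite \<Rightarrow> 'a::real_normed_vector set"
  shows "(\<And>a. compact (K a)) \<Longrightarrow> compact (minkowski K s)"
  unfolding minkowski_eq_sum by (intro compact_set_sum compact_scaling)

lemma minkowski_nonempty: "(\<And>a. K a \<noteq> {}) \<Longrightarrow> minkowski K s \<noteq> {}"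
  unfolding minkowski_def by (auto simp: ex_in_conv[symmetric] intro!: choice)

text \<open>Gradient of the convex potential \<Sum> \<open>s a * ln (expsum (V a) x)\<close>. For
  positive \<open>s\<close> and vertex sets that do not all lie in parallel hyperplanes it
  parametrises the Minkowski combination of the hulls by the whole space, up to a null set.\<close>

definition moment_map :: "('i::finite \<Rightarrow> 'a::real_inner set) \<Rightarrow> ('i \<Rightarrow> real) \<Rightarrow> 'a \<Rightarrow> 'a" where
  "moment_map V s x = (\<Sum>a\<in>UNIV. s a *\<^sub>R gibbs_mean (V a) x)"

text \<open>Coefficient of \<Prod> \<open>s (\<psi> i)\<close> in the Jacobian determinant of
  \<open>moment_map V s\<close> at \<open>x\<close>. A map \<phi> selects a body and one of its
  points for each row; \<psi> records the bodies only.\<close>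

definition mixed_density :: "('i::finite \<Rightarrow> (real^'m) set) \<Rightarrow> ('m \<Rightarrow> 'i) \<Rightarrow> real^'m \<Rightarrow> real" where
  "mixed_density V \<psi> x = (\<Sum>\<phi> | (\<forall>i. \<phi> i \<in> Sigma UNIV V) \<and> fst \<circ> \<phi> = \<psi>.
      (\<Prod>i\<in>UNIV. gibbs (V (fst (\<phi> i))) x (snd (\<phi> i))) *
      (det (\<chi> i. snd (\<phi> i) - gibbs_mean (V (fst (\<phi> i))) x))\<^sup>2) / fact CARD('m)"

context
  fixes V :: "'i::finite \<Rightarrow> 'a::euclidean_space set"
  assumes V: "\<And>a. finite (V a)" "\<And>a. V a \<noteq> {}"
begin

lemma moment_map_in_minkowski: "moment_map V s x \<in> minkowski (\<lambda>a. convex hull (V a)) s"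
  unfolding minkowski_def moment_map_def
  by (intro CollectI exI[of _ "\<lambda>a. gibbs_mean (V a) x"]) (simp add: gibbs_mean_in_hull V)

text \<open>The function \<open>F\<close> has gradient \<open>moment_map V s x - y\<close>. A ball
  around \<open>y\<close> inside the combination makes \<open>F\<close> coercive, so it has a
  minimiser, and there the gradient vanishes.\<close>

lemma interior_minkowski_subset_range:
  assumes s: "\<And>a. 0 \<le> s a" and y: "y \<in> interior (minkowski (\<lambda>a. convex hull (V a)) s)"
  shows "y \<in> range (moment_map V s)"
proof -
  let ?Q = "minkowski (\<lambda>a. convex hull (V a)) s"
  obtain e where e: "0 < e" "cball y e \<subseteq> ?Q"
    using y by (auto simp: mem_interior_cball)
  define F where "F x = (\<Sum>a\<in>UNIV. s a * ln (expsum (V a) x)) - x \<bullet> y" for x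
  have F_ge: "e * norm x \<le> F x" for x
  proof -
    \<comment> \<open>A step of length \<open>e\<close> from \<open>y\<close> in the direction of
      \<open>x\<close> stays in the set; for \<open>x = 0\<close> the point is \<open>y\<close>
      itself.\<close>
    have "y + (e / norm x) *\<^sub>R x \<in> ?Q"
      using e by (intro subsetD[OF e(2)]) (auto simp: dist_norm)
    then obtain q where q: "\<And>a. q a \<in> convex hull (V a)" "y + (e / norm x) *\<^sub>R x = (\<Sum>a\<in>UNIV. s a *\<^sub>R q a)"
      unfolding minkowski_def by blast
    have "x \<bullet> y + e * norm x = x \<bullet> (y + (e / norm x) *\<^sub>R x)"
      by (simp add: inner_add_right power2_norm_eq_inner[symmetric] power2_eq_square)
    also have "\<dots> = (\<Sum>a\<in>UNIV. s a * (x \<bullet> q a))"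
      unfolding q by (simp add: inner_sum_right)
    also have "\<dots> \<le> (\<Sum>a\<in>UNIV. s a * ln (expsum (V a) x))"
      by (intro sum_mono mult_left_mono inner_le_ln_expsum V q s)
    finally show ?thesis by (simp add: F_def)
  qed
  have F_deriv: "(F has_derivative (\<lambda>h. h \<bullet> (moment_map V s x - y))) (at x within S)" for x S
  proof -
    have "(F has_derivative (\<lambda>h. (\<Sum>a\<in>UNIV. s a * (h \<bullet> gibbs_mean (V a) x)) - h \<bullet> y)) (at x within S)"
      unfolding F_def[abs_def]
      by (intro has_derivative_diff has_derivative_sum has_derivative_mult_right
          has_derivative_ln_expsum V has_derivative_inner_left has_derivative_ident)
    then show ?thesis
      by (simp add: moment_map_def inner_diff_right inner_sum_right)
  qed
  have "continuous_on (cball 0 (F 0 / e)) F"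
    by (rule has_derivative_continuous_on[OF F_deriv])
  moreover have "0 \<le> F 0" using F_ge[of 0] by simp
  then have "cball 0 (F 0 / e) \<noteq> ({} :: 'a set)" using e by (auto simp: not_less)
  ultimately obtain x where x: "x \<in> cball 0 (F 0 / e)" "\<And>z. z \<in> cball 0 (F 0 / e) \<Longrightarrow> F x \<le> F z"
    using continuous_attains_inf[OF compact_cball] by metis
  \<comment> \<open>Outside the ball of radius \<open>F 0 / e\<close> the bound \<open>F_ge\<close>
    exceeds \<open>F 0\<close>, so the minimum over the ball is global.\<close>
  have min: "F x \<le> F z" for z
  proof (cases "z \<in> cball 0 (F 0 / e)")
    case False
    then have "F 0 < e * norm z" using e by (simp add: field_simps)
    moreover have "F x \<le> F 0" using \<open>0 \<le> F 0\<close> e by (intro x) auto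
    ultimately show ?thesis using F_ge[of z] by linarith
  qed (use x in auto)
  have "(\<lambda>h. h \<bullet> (moment_map V s x - y)) = (\<lambda>_. 0)"
    using min by (intro differential_zero_maxmin[of x UNIV F] F_deriv) auto
  then have "(moment_map V s x - y) \<bullet> (moment_map V s x - y) = 0" by metis
  then show ?thesis by auto
qed

text \<open>Strict convexity of the potential: with equal gradients at \<open>x\<close> and
  \<open>y\<close>, the tangent inequalities in the two directions contradict each other once one is
  strict. \<open>nondeg\<close> supplies a body on which \<open>y - x\<close> is not constant, which
  makes the first one strict.\<close>

lemma inj_moment_map:
  assumes s: "\<And>a. 0 < s a"
    and nondeg: "\<And>u. u \<noteq> 0 \<Longrightarrow> \<exists>a. \<forall>t. \<exists>v\<in>V a. u \<bullet> v \<noteq> t"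
  shows "inj (moment_map V s)"
proof (rule injI, rule ccontr)
  fix x y assume eq: "moment_map V s x = moment_map V s y" and "x \<noteq> y"
  define F where "F x = (\<Sum>a\<in>UNIV. s a * ln (expsum (V a) x))" for x
  obtain a v where v: "v \<in> V a" "(y - x) \<bullet> v \<noteq> (y - x) \<bullet> gibbs_mean (V a) x"
    using nondeg[of "y - x"] \<open>x \<noteq> y\<close> by (metis eq_iff_diff_eq_0)
  have tangent: "F x + (y - x) \<bullet> moment_map V s x =
      (\<Sum>a\<in>UNIV. s a * (ln (expsum (V a) x) + (y - x) \<bullet> gibbs_mean (V a) x))" for x y
    by (simp add: F_def moment_map_def inner_sum_right distrib_left sum.distrib)
  have "F x + (y - x) \<bullet> moment_map V s x < F y"
    unfolding tangent unfolding F_def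
    by (intro sum_strict_mono_ex1)
       (auto intro!: bexI[of _ a] ln_expsum_above_tangent(1)[OF V] ln_expsum_above_tangent(2)[OF V v] simp: s less_imp_le)
  moreover have "F y + (x - y) \<bullet> moment_map V s y \<le> F x"
    unfolding tangent unfolding F_def
    by (intro sum_mono mult_left_mono ln_expsum_above_tangent(1)[OF V] less_imp_le[OF s])
  ultimately show False
    unfolding eq by (simp add: inner_diff_left)
qed

end

text \<open>The Jacobian is a sum over pairs \<open>(a, v)\<close> of rank one matrices weighted by
  \<open>s a\<close> times a Gibbs weight, so Cauchy-Binet applies; grouping the maps \<phi> by
  \<open>fst \<circ> \<phi>\<close> isolates the dependence on \<open>s\<close>.\<close>

lemma moment_map_has_derivative:
  fixes V :: "'i::finite \<Rightarrow> (real^'m) set"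
  assumes V: "\<And>a. finite (V a)" "\<And>a. V a \<noteq> {}"
  obtains T where "(moment_map V s has_derivative T) (at x within S)"
    and "det (matrix T) = (\<Sum>\<psi>\<in>UNIV. mixed_density V \<psi> x * (\<Prod>i\<in>UNIV. s (\<psi> i)))"
proof
  define T where "T h = (\<Sum>a\<in>UNIV. s a *\<^sub>R
      (\<Sum>v\<in>V a. (gibbs (V a) x v * ((v - gibbs_mean (V a) x) \<bullet> h)) *\<^sub>R (v - gibbs_mean (V a) x)))" for h
  show "(moment_map V s has_derivative T) (at x within S)"
    unfolding moment_map_def[abs_def] T_def[abs_def]
    by (intro has_derivative_sum has_derivative_scaleR_right has_derivative_gibbs_mean V)
  define X where "X = Sigma UNIV V"
  define b where "b k = s (fst k) * gibbs (V (fst k)) x (snd k)" for k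
  define u where "u k = snd k - gibbs_mean (V (fst k)) x" for k
  have fin: "finite X" using V by (simp add: X_def)
  have finF: "finite {\<phi>::'m \<Rightarrow> 'i \<times> (real^'m). \<forall>i. \<phi> i \<in> X}"
    using finite_PiE[of "UNIV :: 'm set" "\<lambda>_. X"] fin by (simp add: PiE_UNIV_domain Pi_def)
  have "matrix T = (\<chi> i j. \<Sum>k\<in>X. b k * (u k $ i * u k $ j))"
  proof -
    have "(\<Sum>k\<in>X. b k * (u k $ i * u k $ j)) = (\<Sum>a\<in>UNIV. \<Sum>v\<in>V a. b (a, v) * (u (a, v) $ i * u (a, v) $ j))" for i j
      unfolding X_def using V by (subst sum.Sigma) (auto simp: case_prod_beta)
    then show ?thesis
      unfolding matrix_def T_def
      by (simp add: vec_eq_iff b_def u_def inner_axis sum_distrib_left mult_ac)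
  qed
  then have "det (matrix T) = (\<Sum>\<phi>\<in>{\<phi>. \<forall>i. \<phi> i \<in> X}.
      (\<Prod>i\<in>UNIV. b (\<phi> i)) * (det (\<chi> i. u (\<phi> i)))\<^sup>2) / fact CARD('m)"
    by (simp only: det_sum_rank_one[OF fin])
  also have "(\<Sum>\<phi>\<in>{\<phi>. \<forall>i. \<phi> i \<in> X}. (\<Prod>i\<in>UNIV. b (\<phi> i)) * (det (\<chi> i. u (\<phi> i)))\<^sup>2) =
      (\<Sum>\<psi>\<in>UNIV. \<Sum>\<phi>\<in>{\<phi> \<in> {\<phi>. \<forall>i. \<phi> i \<in> X}. fst \<circ> \<phi> = \<psi>}.
        (\<Prod>i\<in>UNIV. b (\<phi> i)) * (det (\<chi> i. u (\<phi> i)))\<^sup>2)"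
    by (rule sum.group[symmetric]) (use finF in auto)
  also have "\<dots> = (\<Sum>\<psi>\<in>UNIV. \<Sum>\<phi> | (\<forall>i. \<phi> i \<in> X) \<and> fst \<circ> \<phi> = \<psi>.
      (\<Prod>i\<in>UNIV. s (\<psi> i)) * ((\<Prod>i\<in>UNIV. gibbs (V (fst (\<phi> i))) x (snd (\<phi> i))) *
      (det (\<chi> i. u (\<phi> i)))\<^sup>2))"
    by (intro sum.cong) (auto simp: b_def prod.distrib)
  finally show "det (matrix T) = (\<Sum>\<psi>\<in>UNIV. mixed_density V \<psi> x * (\<Prod>i\<in>UNIV. s (\<psi> i)))"
    by (simp add: mixed_density_def X_def u_def sum_distrib_left sum_divide_distrib mult.commute)
qed

lemma mixed_density_nonneg:
  assumes "\<And>a. finite (V a)" "\<And>a. V a \<noteq> {}"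
  shows "0 \<le> mixed_density V \<psi> x"
  unfolding mixed_density_def
  by (intro divide_nonneg_nonneg sum_nonneg mult_nonneg_nonneg prod_nonneg)
     (auto simp: gibbs_pos[OF assms] less_imp_le)

lemma continuous_on_mixed_density:
  assumes V: "\<And>a. finite (V a)" "\<And>a. V a \<noteq> {}"
  shows "continuous_on S (mixed_density V \<psi>)"
proof -
  have m: "continuous_on S (gibbs_mean (V a))" for a
    by (rule has_derivative_continuous_on[OF has_derivative_gibbs_mean[OF V]])
  have g: "continuous_on S (\<lambda>x. gibbs (V a) x v)" for a v
    unfolding gibbs_def expsum_def
    using expsum_pos[OF V, of a] unfolding expsum_def
    by (intro continuous_intros) (auto simp: less_imp_neq[symmetric])
  show ?thesis
    unfolding mixed_density_def[abs_def] det_def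
    by (auto intro!: continuous_intros m g)
qed

text \<open>Change of variables along the injective moment map; the coefficients are the integrals
  of the mixed densities.\<close>

lemma measure_minkowski_polytopes:
  fixes V :: "'i::finite \<Rightarrow> (real^'m::{finite,wellorder}) set"
  assumes V: "\<And>a. finite (V a)" "\<And>a. V a \<noteq> {}"
  obtains c :: "('m \<Rightarrow> 'i) \<Rightarrow> real" where "\<And>\<psi>. 0 \<le> c \<psi>"
    and "\<And>s. (\<And>a. 0 < s a) \<Longrightarrow> measure lebesgue (minkowski (\<lambda>a. convex hull (V a)) s) =
      (\<Sum>\<psi>\<in>UNIV. c \<psi> * (\<Prod>i\<in>UNIV. s (\<psi> i)))"
proof (cases "\<exists>u. u \<noteq> 0 \<and> (\<forall>a. \<exists>t. \<forall>v\<in>V a. u \<bullet> v = t)")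
  \<comment> \<open>All \<open>V a\<close> lie in parallel hyperplanes: every combination is
    contained in a hyperplane, and the zero polynomial works.\<close>
  case True
  then obtain u t where u: "u \<noteq> 0" "\<And>a v. v \<in> V a \<Longrightarrow> u \<bullet> v = t a" by metis
  have hull: "convex hull (V a) \<subseteq> {x. u \<bullet> x = t a}" for a
    using u by (intro hull_minimal convex_hyperplane) auto
  have sub: "minkowski (\<lambda>a. convex hull (V a)) s \<subseteq> {x. u \<bullet> x = (\<Sum>a\<in>UNIV. s a * t a)}" for s
    using hull by (fastforce simp: minkowski_def inner_sum_right intro!: sum.cong)
  have zero: "measure lebesgue (minkowski (\<lambda>a. convex hull (V a)) s) = 0" for s
    by (rule negligible_imp_measure0[OF negligible_subset[OF negligible_hyperplane sub]]) (simp add: u)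
  show ?thesis by (rule that[of "\<lambda>_. 0"]) (simp_all add: zero)
next
  case False
  then have nondeg: "\<exists>a. \<forall>t. \<exists>v\<in>V a. u \<bullet> v \<noteq> t" if "u \<noteq> 0" for u
    using that by metis
  let ?Q = "minkowski (\<lambda>a. convex hull (V a))"
  let ?D = "\<lambda>s x. \<Sum>\<psi>\<in>UNIV. mixed_density V \<psi> x * (\<Prod>i\<in>UNIV. s (\<psi> i))"
  have vol: "?D s integrable_on UNIV \<and> measure lebesgue (?Q s) = integral UNIV (?D s)"
    if s: "\<And>a. 0 < s a" for s
  proof -
    have "\<exists>T. (moment_map V s has_derivative T) (at x) \<and> det (matrix T) = ?D s x" for x
      by (rule moment_map_has_derivative[of V s x UNIV, OF V]) blast
    then obtain T where T: "\<And>x. (moment_map V s has_derivative T x) (at x)"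
        "\<And>x. det (matrix (T x)) = ?D s x" by metis
    have abs: "\<bar>det (matrix (T x))\<bar> = ?D s x" for x
      unfolding T(2) by (intro abs_of_nonneg sum_nonneg mult_nonneg_nonneg prod_nonneg mixed_density_nonneg V)
        (simp add: s less_imp_le)
    have cvx: "convex (?Q s)" "compact (?Q s)"
      using V by (auto intro!: convex_minkowski compact_minkowski finite_imp_compact_convex_hull)
    have lm: "?Q s \<in> lmeasurable" using cvx by (simp add: lmeasurable_compact)
    \<comment> \<open>The image contains the interior and is contained in the closed set, and the
      frontier of a convex set is negligible.\<close>
    have "?Q s - range (moment_map V s) \<union> (range (moment_map V s) - ?Q s) \<subseteq> frontier (?Q s)"
      using interior_minkowski_subset_range[OF V, where s = s] moment_map_in_minkowski[OF V, where s = s] s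
        compact_imp_closed[OF cvx(2)]
      by (auto simp: frontier_def less_imp_le)
    then have neg: "negligible (?Q s - range (moment_map V s) \<union> (range (moment_map V s) - ?Q s))"
      using negligible_convex_frontier[OF cvx(1)] negligible_subset by blast
    have inj: "inj (moment_map V s)" using inj_moment_map[OF V s nondeg] .
    have "range (moment_map V s) \<in> lmeasurable"
      using lmeasurable_negligible_symdiff[OF lm neg] .
    then have int: "?D s integrable_on UNIV"
      using measurable_differentiable_image_eq[of UNIV "moment_map V s" T, OF _ T(1) inj] by (simp add: abs)
    have "measure lebesgue (range (moment_map V s)) = integral UNIV (?D s)"
      using measure_differentiable_image_eq[of UNIV "moment_map V s" T, OF _ T(1) inj] int by (simp add: abs)
    with int measure_negligible_symdiff[OF lm neg] show ?thesis by simp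
  qed
  \<comment> \<open>Each density is dominated by the full Jacobian determinant at
    \<open>s = 1\<close>, whose integrability is part of \<open>vol\<close>.\<close>
  have int: "mixed_density V \<psi> integrable_on UNIV" for \<psi>
  proof (rule measurable_bounded_by_integrable_imp_integrable_real)
    show "mixed_density V \<psi> \<in> borel_measurable (lebesgue_on UNIV)"
      by (intro continuous_imp_measurable_on_sets_lebesgue continuous_on_mixed_density V) auto
    show "?D (\<lambda>_. 1) integrable_on UNIV" using vol[of "\<lambda>_. 1"] by simp
    show "\<bar>mixed_density V \<psi> x\<bar> \<le> ?D (\<lambda>_. 1) x" for x
      using member_le_sum[of \<psi> UNIV "\<lambda>\<psi>. mixed_density V \<psi> x"] mixed_density_nonneg[of V, OF V]
      by simp
  qed auto
  show ?thesis
  proof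
    show "0 \<le> integral UNIV (mixed_density V \<psi>)" for \<psi>
      by (intro integral_nonneg int mixed_density_nonneg V)
    show "measure lebesgue (?Q s) = (\<Sum>\<psi>\<in>UNIV. integral UNIV (mixed_density V \<psi>) * (\<Prod>i\<in>UNIV. s (\<psi> i)))"
      if "\<And>a. 0 < s a" for s
      using vol[OF that] by (simp add: integral_sum int integrable_on_mult_left)
  qed
qed

section \<open>Volumes of Minkowski combinations of convex bodies\<close>

text \<open>The vertices come from a finite \<delta>-net of \<open>K\<close> plus the corners of a
  cube of half side \<delta>: the cube absorbs the error of the net.\<close>

lemma polytope_circumscribed:
  fixes K :: "'a::euclidean_space set"
  assumes K: "compact K" "convex K" "K \<noteq> {}" and d: "0 < d"
  obtains V where "finite V" "V \<noteq> {}" "K \<subseteq> convex hull V"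
    and "\<And>x. x \<in> convex hull V \<Longrightarrow> \<exists>y\<in>K. norm (x - y) \<le> d"
proof -
  \<comment> \<open>If all coordinates are at most \<delta> in absolute value, the l1 bound gives
    norm at most \<open>DIM('a) * \<delta>\<close>, which is \<open>d\<close>.\<close>
  define \<delta> where "\<delta> = d / DIM('a)"
  have \<delta>: "0 < \<delta>" using d by (simp add: \<delta>_def)
  obtain S :: "'a set" where S: "finite S"
      "cbox (0 - (\<Sum>i\<in>Basis. \<delta> *\<^sub>R i)) (0 + (\<Sum>i\<in>Basis. \<delta> *\<^sub>R i)) = convex hull S"
    using cube_convex_hull[OF \<delta>] by blast
  have cube: "x \<in> convex hull S \<longleftrightarrow> (\<forall>i\<in>Basis. \<bar>x \<bullet> i\<bar> \<le> \<delta>)" for x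
    unfolding S(2)[symmetric] mem_box by (auto simp: abs_le_iff inner_sum_left inner_Basis if_distrib cong: if_cong)
  obtain F where F: "finite F" "F \<subseteq> K" "K \<subseteq> (\<Union>x\<in>F. ball x \<delta>)"
    by (rule compactE_image[OF K(1), of K "\<lambda>x. ball x \<delta>"]) (use \<delta> in auto)
  have "0 \<in> convex hull S" using \<delta> by (simp add: cube)
  then have "S \<noteq> {}" by auto
  moreover have "F \<noteq> {}" using F K(3) by auto
  ultimately have ne: "F + S \<noteq> {}" by (auto simp: set_plus_def)
  have hull: "convex hull (F + S) = convex hull F + convex hull S"
    by (rule convex_hull_set_plus)
  show thesis
  proof
    show "finite (F + S)" using F S by (simp add: finite_set_plus)
    show "F + S \<noteq> {}" by fact
    show "K \<subseteq> convex hull (F + S)"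
    proof
      fix x assume "x \<in> K"
      then obtain f where f: "f \<in> F" "norm (x - f) < \<delta>"
        using F(3) by (auto simp: dist_norm norm_minus_commute)
      have "x - f \<in> convex hull S"
        unfolding cube using f Basis_le_norm[of _ "x - f"] by force
      then have "f + (x - f) \<in> convex hull (F + S)"
        unfolding hull using f by (intro set_plus_intro) (auto intro: hull_inc)
      then show "x \<in> convex hull (F + S)" by simp
    qed
    fix x assume "x \<in> convex hull (F + S)"
    then obtain y z where x: "x = y + z" "y \<in> convex hull F" "z \<in> convex hull S"
      unfolding hull by (auto elim: set_plus_elim)
    have "y \<in> K" using x F(2) K(2) by (meson hull_minimal subsetD)
    moreover have "norm z \<le> (\<Sum>i\<in>Basis. \<bar>z \<bullet> i\<bar>)" by (rule norm_le_l1)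
    moreover have "\<dots> \<le> (\<Sum>i\<in>(Basis::'a set). \<delta>)" using x(3) unfolding cube by (intro sum_mono) auto
    ultimately show "\<exists>y\<in>K. norm (x - y) \<le> d" by (intro bexI[of _ y]) (auto simp: x(1) \<delta>_def)
  qed
qed

text \<open>Continuity from above: the closed neighbourhoods are compact, decrease, and intersect in
  the closed set \<open>S\<close>.\<close>

lemma measure_infdist_le_tendsto:
  fixes S :: "'a::euclidean_space set"
  assumes S: "compact S" "S \<noteq> {}" and r: "decseq r" "\<And>k. 0 < r k" "r \<longlonglongrightarrow> 0"
  shows "(\<lambda>k. measure lebesgue {x. infdist x S \<le> r k}) \<longlonglongrightarrow> measure lebesgue S"
proof -
  let ?A = "\<lambda>k. {x. infdist x S \<le> r k}"
  have cA: "compact (?A k)" for k using S r by (intro compact_infdist_le) auto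
  have "(\<Inter>k. ?A k) = S"
  proof (intro subset_antisym subsetI)
    fix x assume "x \<in> (\<Inter>k. ?A k)"
    then have "infdist x S \<le> 0" by (intro LIMSEQ_le_const[OF r(3)]) auto
    then show "x \<in> S"
      using S infdist_nonneg[of x S] by (simp add: in_closed_iff_infdist_zero compact_imp_closed)
  qed (use r in \<open>auto intro: less_imp_le\<close>)
  moreover have "(\<lambda>k. measure lebesgue (?A k)) \<longlonglongrightarrow> measure lebesgue (\<Inter>k. ?A k)"
  proof (rule Lim_measure_decseq)
    show "range ?A \<subseteq> sets lebesgue" using cA by (auto intro: lmeasurable_compact fmeasurableD)
    show "decseq ?A" using r(1) by (fastforce simp: decseq_def)
    show "emeasure lebesgue (?A k) \<noteq> \<infinity>" for k
      using fmeasurableD2[OF lmeasurable_compact[OF cA]] by simp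
  qed
  ultimately show ?thesis by simp
qed

text \<open>The coefficients belonging to circumscribed polytopes are bounded, so a subsequence
  converges; the polytope volumes are squeezed to the volume for \<open>K\<close>, which is
  therefore the limit polynomial.\<close>

lemma measure_minkowski_cart:
  fixes K :: "'i::finite \<Rightarrow> (real^'m::{finite,wellorder}) set"
  assumes K: "\<And>a. compact (K a)" "\<And>a. convex (K a)" "\<And>a. K a \<noteq> {}"
  obtains c :: "('m \<Rightarrow> 'i) \<Rightarrow> real" where "\<And>\<psi>. 0 \<le> c \<psi>"
    and "\<And>s. (\<And>a. 0 \<le> s a) \<Longrightarrow>
      measure lebesgue (minkowski K s) = (\<Sum>\<psi>\<in>UNIV. c \<psi> * (\<Prod>i\<in>UNIV. s (\<psi> i)))"
proof -
  define d where "d k = 1 / real (Suc k)" for k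
  have d: "0 < d k" "d k \<le> 1" for k by (auto simp: d_def)
  have d0: "d \<longlonglongrightarrow> 0" unfolding d_def by (rule LIMSEQ_Suc[OF lim_1_over_n])
  define A where "A k a V \<longleftrightarrow> finite V \<and> V \<noteq> {} \<and> K a \<subseteq> convex hull V \<and>
      (\<forall>x\<in>convex hull V. \<exists>y\<in>K a. norm (x - y) \<le> d k)" for k a V
  have "\<exists>V. A k a V" for k a
    unfolding A_def by (rule polytope_circumscribed[of "K a" "d k", OF K d(1)]) blast
  then obtain V where "A k a (V k a)" for k a by metis
  then have V: "finite (V k a)" "V k a \<noteq> {}" "K a \<subseteq> convex hull V k a"
      "x \<in> convex hull V k a \<Longrightarrow> \<exists>y\<in>K a. norm (x - y) \<le> d k" for k a x
    unfolding A_def by auto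
  let ?P = "\<lambda>k. minkowski (\<lambda>a. convex hull V k a)"
  define C where "C k c \<longleftrightarrow> (\<forall>\<psi>. 0 \<le> c \<psi>) \<and> (\<forall>s. (\<forall>a. 0 < s a) \<longrightarrow>
      measure lebesgue (?P k s) = (\<Sum>\<psi>\<in>UNIV. c \<psi> * (\<Prod>i\<in>UNIV. s (\<psi> i))))"
    for k and c :: "('m \<Rightarrow> 'i) \<Rightarrow> real"
  have "\<exists>c. C k c" for k
    unfolding C_def by (rule measure_minkowski_polytopes[of "V k", OF V(1,2)]) blast
  then obtain c where "C k (c k)" for k by metis
  then have c: "0 \<le> c k \<psi>" "(\<And>a. 0 < s a) \<Longrightarrow>
        measure lebesgue (?P k s) = (\<Sum>\<psi>\<in>UNIV. c k \<psi> * (\<Prod>i\<in>UNIV. s (\<psi> i)))" for k \<psi> s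
    unfolding C_def by auto
  have "bounded (\<Union>a. K a)" by (intro bounded_UN ballI compact_imp_bounded K) simp
  then obtain B where B: "0 < B" "\<And>a x. x \<in> K a \<Longrightarrow> norm x \<le> B"
    unfolding bounded_pos by blast
  \<comment> \<open>Error factor: after the shift by \<open>d k\<close> the summand of index
    \<open>a\<close> moves by at most \<open>(s a + B + 1) * d k\<close>.\<close>
  define R where "R s = (\<Sum>a\<in>UNIV. s a + B + 1)" for s :: "'i \<Rightarrow> real"
  have R: "0 < R s" if "\<And>a. 0 \<le> s a" for s
    unfolding R_def using that B by (intro sum_pos) (auto intro: add_nonneg_pos)
  have cm: "compact (minkowski K s)" "minkowski K s \<noteq> {}" for s
    using K by (auto intro!: compact_minkowski minkowski_nonempty)
  have cP: "compact (?P k s)" for k s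
    using V by (auto intro!: compact_minkowski finite_imp_compact_convex_hull)
  \<comment> \<open>The shift by \<open>d k\<close> makes the parameters positive, as the polytope
    formula requires; in the limit, parameters equal to 0 are reached as well.\<close>
  have upper: "measure lebesgue (?P k (\<lambda>a. s a + d k)) \<le> measure lebesgue {x. infdist x (minkowski K s) \<le> R s * d k}"
    if s: "\<And>a. 0 \<le> s a" for s k
  proof (rule measure_mono_fmeasurable)
    show "?P k (\<lambda>a. s a + d k) \<subseteq> {x. infdist x (minkowski K s) \<le> R s * d k}"
    proof
      fix x assume "x \<in> ?P k (\<lambda>a. s a + d k)"
      then obtain q where q: "\<And>a. q a \<in> convex hull V k a" "x = (\<Sum>a\<in>UNIV. (s a + d k) *\<^sub>R q a)"
        unfolding minkowski_def by blast
      have "\<forall>a. \<exists>y. y \<in> K a \<and> norm (q a - y) \<le> d k" using V(4) q(1) by blast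
      then obtain y where y: "\<And>a. y a \<in> K a" "\<And>a. norm (q a - y a) \<le> d k" by metis
      have "norm ((s a + d k) *\<^sub>R q a - s a *\<^sub>R y a) \<le> (s a + B + 1) * d k" for a
      proof -
        have "(s a + d k) *\<^sub>R q a - s a *\<^sub>R y a = (s a + d k) *\<^sub>R (q a - y a) + d k *\<^sub>R y a"
          by (simp add: algebra_simps)
        also have "norm \<dots> \<le> (s a + d k) * norm (q a - y a) + d k * norm (y a)"
          using s[of a] d(1)[of k] norm_triangle_ineq[of "(s a + d k) *\<^sub>R (q a - y a)" "d k *\<^sub>R y a"] by simp
        also have "\<dots> \<le> (s a + d k) * d k + d k * B"
          using s[of a] d(1)[of k] y B(2) by (intro add_mono mult_left_mono) auto
        also have "\<dots> \<le> (s a + B + 1) * d k"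
          using d[of k] by (simp add: algebra_simps)
        finally show ?thesis .
      qed
      then have "norm (\<Sum>a\<in>UNIV. (s a + d k) *\<^sub>R q a - s a *\<^sub>R y a) \<le> R s * d k"
        unfolding R_def sum_distrib_right by (intro sum_norm_le) auto
      then have "dist x (\<Sum>a\<in>UNIV. s a *\<^sub>R y a) \<le> R s * d k"
        by (simp add: q(2) dist_norm sum_subtractf)
      moreover have "(\<Sum>a\<in>UNIV. s a *\<^sub>R y a) \<in> minkowski K s" using y unfolding minkowski_def by blast
      ultimately show "x \<in> {x. infdist x (minkowski K s) \<le> R s * d k}"
        using infdist_le order_trans by blast
    qed
    show "{x. infdist x (minkowski K s) \<le> R s * d k} \<in> lmeasurable"
      using R[OF s] d cm by (intro lmeasurable_compact compact_infdist_le) auto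
    show "?P k (\<lambda>a. s a + d k) \<in> sets lebesgue" using cP by (simp add: lmeasurable_compact fmeasurableD)
  qed
  \<comment> \<open>The bodies need not contain 0, so enlarging the parameters gives an inclusion
    only up to translation: \<open>d k\<close> times fixed points \<open>x a\<close> are added and
    absorbed by convexity.\<close>
  have lower: "measure lebesgue (minkowski K s) \<le> measure lebesgue (?P k (\<lambda>a. s a + d k))"
    if s: "\<And>a. 0 \<le> s a" for s k
  proof -
    have "\<forall>a. \<exists>x. x \<in> K a" using K(3) by blast
    then obtain x where x: "\<And>a. x a \<in> K a" by metis
    let ?t = "\<Sum>a\<in>UNIV. d k *\<^sub>R x a"
    have "(+) ?t ` minkowski K s \<subseteq> ?P k (\<lambda>a. s a + d k)"
    proof safe
      fix z assume "z \<in> minkowski K s"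
      then obtain q where q: "\<And>a. q a \<in> K a" "z = (\<Sum>a\<in>UNIV. s a *\<^sub>R q a)" unfolding minkowski_def by blast
      define q' where "q' a = (s a / (s a + d k)) *\<^sub>R q a + (d k / (s a + d k)) *\<^sub>R x a" for a
      have pos: "0 < s a + d k" for a using s[of a] d(1)[of k] by linarith
      have "q' a \<in> K a" for a
        unfolding q'_def using pos[of a] s[of a] d(1)[of k]
        by (intro convexD[OF K(2)] q x) (simp_all flip: add_divide_distrib)
      then have "q' a \<in> convex hull V k a" for a using V(3) by blast
      moreover have "(s a + d k) *\<^sub>R q' a = s a *\<^sub>R q a + d k *\<^sub>R x a" for a
        using pos[of a] by (simp add: q'_def scaleR_add_right)
      then have "?t + z = (\<Sum>a\<in>UNIV. (s a + d k) *\<^sub>R q' a)"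
        by (simp add: q(2) sum.distrib)
      ultimately show "?t + z \<in> ?P k (\<lambda>a. s a + d k)" unfolding minkowski_def by blast
    qed
    then have "measure lebesgue ((+) ?t ` minkowski K s) \<le> measure lebesgue (?P k (\<lambda>a. s a + d k))"
      using cP cm(1) by (intro measure_mono_fmeasurable)
        (auto simp: lmeasurable_compact fmeasurableD compact_translation)
    then show ?thesis by (simp add: measure_translation)
  qed
  define p where "p k s = (\<Sum>\<psi>\<in>UNIV. c k \<psi> * (\<Prod>i\<in>UNIV. s (\<psi> i) + d k))" for k s
  have p: "p k s = measure lebesgue (?P k (\<lambda>a. s a + d k))" if "\<And>a. 0 \<le> s a" for s k
    unfolding p_def by (subst c(2)) (auto intro: add_nonneg_pos that d)
  have p_lim: "(\<lambda>k. p k s) \<longlonglongrightarrow> measure lebesgue (minkowski K s)" if s: "\<And>a. 0 \<le> s a" for s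
  proof (rule real_tendsto_sandwich[OF _ _ tendsto_const])
    show "(\<lambda>k. measure lebesgue {x. infdist x (minkowski K s) \<le> R s * d k}) \<longlonglongrightarrow> measure lebesgue (minkowski K s)"
    proof (rule measure_infdist_le_tendsto[OF cm])
      show "decseq (\<lambda>k. R s * d k)"
        using R[OF s] by (auto simp: decseq_def d_def field_simps intro!: mult_left_mono)
      show "0 < R s * d k" for k using R[OF s] d by simp
      show "(\<lambda>k. R s * d k) \<longlonglongrightarrow> 0" using tendsto_mult_left[OF d0, of "R s"] by simp
    qed
  qed (use p[OF s] lower[OF s] upper[OF s] in auto)
  \<comment> \<open>At \<open>s = 1\<close> every product in \<open>p\<close> is at least 1, so the
    convergent values bound each of the nonnegative coefficients.\<close>
  have "bounded (range (\<lambda>k. p k (\<lambda>_. 1)))"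
    by (rule convergent_imp_bounded[OF p_lim]) simp
  then obtain M where M: "\<And>k. \<bar>p k (\<lambda>_. 1)\<bar> \<le> M" by (auto simp: bounded_iff)
  have cM: "\<bar>c k \<psi>\<bar> \<le> M" for k \<psi>
  proof -
    have "c k \<psi> * 1 \<le> c k \<psi> * (\<Prod>i\<in>(UNIV::'m set). 1 + d k)"
      using c(1) d(1)[of k] by (intro mult_left_mono) (auto intro!: one_le_power)
    also have "\<dots> \<le> p k (\<lambda>_. 1)"
      unfolding p_def using c(1) d(1)[of k]
      by (intro member_le_sum) (auto intro!: mult_nonneg_nonneg)
    finally show ?thesis using M[of k] c(1)[of k \<psi>] by linarith
  qed
  \<comment> \<open>The finitely many coefficients form one vector, so a single subsequence makes
    all of them converge.\<close>
  define x where "x k = (\<chi> \<psi>. c k \<psi>)" for k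
  have "bounded (range x)"
    unfolding bounded_iff
  proof (intro exI ballI)
    fix v assume "v \<in> range x"
    then obtain k where "v = x k" by auto
    then have "norm v \<le> (\<Sum>\<psi>\<in>UNIV. \<bar>c k \<psi>\<bar>)" using norm_le_l1_cart[of "x k"] by (simp add: x_def)
    also have "\<dots> \<le> (\<Sum>\<psi>\<in>(UNIV::('m \<Rightarrow> 'i) set). M)" by (intro sum_mono cM)
    finally show "norm v \<le> (\<Sum>\<psi>\<in>(UNIV::('m \<Rightarrow> 'i) set). M)" .
  qed
  then obtain l r where r: "strict_mono r" "(x \<circ> r) \<longlonglongrightarrow> l"
    using bounded_imp_convergent_subsequence by blast
  have cl: "(\<lambda>k. c (r k) \<psi>) \<longlonglongrightarrow> l $ \<psi>" for \<psi>
    using tendsto_vec_nth[OF r(2), of \<psi>] by (simp add: x_def o_def)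
  show thesis
  proof
    show "0 \<le> l $ \<psi>" for \<psi> using c(1) by (intro LIMSEQ_le_const[OF cl]) auto
    fix s :: "'i \<Rightarrow> real" assume s: "\<And>a. 0 \<le> s a"
    have "(\<lambda>k. s a + d (r k)) \<longlonglongrightarrow> s a + 0" for a
      using LIMSEQ_subseq_LIMSEQ[OF d0 r(1)] by (intro tendsto_intros) (simp add: o_def)
    then have "(\<lambda>k. p (r k) s) \<longlonglongrightarrow> (\<Sum>\<psi>\<in>UNIV. l $ \<psi> * (\<Prod>i\<in>UNIV. s (\<psi> i)))"
      unfolding p_def by (intro tendsto_intros cl) simp
    moreover have "(\<lambda>k. p (r k) s) \<longlonglongrightarrow> measure lebesgue (minkowski K s)"
      using LIMSEQ_subseq_LIMSEQ[OF p_lim[OF s] r(1)] by (simp add: o_def)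
    ultimately show "measure lebesgue (minkowski K s) = (\<Sum>\<psi>\<in>UNIV. l $ \<psi> * (\<Prod>i\<in>UNIV. s (\<psi> i)))"
      using LIMSEQ_unique by blast
  qed
qed

section \<open>Isometric identification of nested and flat coordinate spaces\<close>

lemma linear_orthonormal_inner:
  fixes f :: "'a::euclidean_space \<Rightarrow> 'b::euclidean_space"
  assumes f: "linear f" "bij_betw f Basis Basis" and c: "c \<in> Basis"
  shows "f x \<bullet> f c = x \<bullet> c"
proof -
  have in_Basis: "f b \<in> Basis" if "b \<in> Basis" for b using f(2) that by (auto simp: bij_betw_def)
  have inj: "f b = f c \<longleftrightarrow> b = c" if "b \<in> Basis" for b
    using f(2) that c by (auto simp: bij_betw_def inj_on_def)
  have "f x = f (\<Sum>b\<in>Basis. (x \<bullet> b) *\<^sub>R b)" by (simp add: euclidean_representation)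
  also have "\<dots> = (\<Sum>b\<in>Basis. (x \<bullet> b) *\<^sub>R f b)"
    by (simp add: linear_sum[OF f(1)] linear_scale[OF f(1)])
  finally have "f x \<bullet> f c = (\<Sum>b\<in>Basis. (x \<bullet> b) * (f b \<bullet> f c))"
    by (simp add: inner_sum_left)
  also have "\<dots> = (\<Sum>b\<in>Basis. if b = c then x \<bullet> b else 0)"
    using c by (intro sum.cong) (auto simp: inner_Basis in_Basis inj)
  also have "\<dots> = x \<bullet> c" using c by simp
  finally show ?thesis .
qed

text \<open>The preimage of a box is a box with corresponding sides, because \<open>f\<close>
  matches the two orthonormal bases; boxes determine Lebesgue measure.\<close>

lemma lborel_distr_orthonormal:
  fixes f :: "'a::euclidean_space \<Rightarrow> 'b::euclidean_space"
  assumes f: "linear f" "bij_betw f Basis Basis"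
  shows "distr lborel borel f = lborel"
proof (rule lborel_eqI[symmetric])
  have [measurable]: "f \<in> borel_measurable borel"
    using f(1) by (intro borel_measurable_continuous_onI linear_continuous_on)
      (simp add: linear_conv_bounded_linear)
  fix l u :: 'b assume le: "\<And>b. b \<in> Basis \<Longrightarrow> l \<bullet> b \<le> u \<bullet> b"
  define l' where "l' = (\<Sum>b\<in>Basis. (l \<bullet> f b) *\<^sub>R b)"
  define u' where "u' = (\<Sum>b\<in>Basis. (u \<bullet> f b) *\<^sub>R b)"
  have comp: "l' \<bullet> b = l \<bullet> f b" "u' \<bullet> b = u \<bullet> f b" if "b \<in> Basis" for b
    using that by (simp_all add: l'_def u'_def)
  have im: "f ` Basis = Basis" using f(2) by (simp add: bij_betw_def)
  have "f -` box l u = box l' u'"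
  proof (rule set_eqI)
    fix x
    have "x \<in> f -` box l u \<longleftrightarrow> (\<forall>b\<in>f ` Basis. l \<bullet> b < f x \<bullet> b \<and> f x \<bullet> b < u \<bullet> b)"
      by (simp add: im mem_box)
    also have "\<dots> \<longleftrightarrow> x \<in> box l' u'"
      using comp linear_orthonormal_inner[OF f, of _ x] by (simp add: mem_box)
    finally show "x \<in> f -` box l u \<longleftrightarrow> x \<in> box l' u'" .
  qed
  then have "emeasure (distr lborel borel f) (box l u) = emeasure lborel (box l' u')"
    by (simp add: emeasure_distr)
  also have "\<dots> = (\<Prod>b\<in>Basis. (u' - l') \<bullet> b)"
    using le im by (intro emeasure_lborel_box) (auto simp: comp)
  also have "\<dots> = (\<Prod>b\<in>Basis. (u - l) \<bullet> f b)"
    by (simp add: inner_diff_left comp)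
  also have "\<dots> = (\<Prod>b\<in>Basis. (u - l) \<bullet> b)"
    using prod.reindex_bij_betw[OF f(2), of "\<lambda>b. (u - l) \<bullet> b"] by simp
  finally show "emeasure (distr lborel borel f) (box l u) = (\<Prod>b\<in>Basis. (u - l) \<bullet> b)" .
qed simp

lemma measure_orthonormal_image:
  fixes f :: "'a::euclidean_space \<Rightarrow> 'b::euclidean_space"
  assumes f: "linear f" "bij_betw f Basis Basis" and S: "compact S"
  shows "measure lebesgue (f ` S) = measure lebesgue S"
proof -
  have cont: "continuous_on A f" for A
    using f(1) by (intro linear_continuous_on) (simp add: linear_conv_bounded_linear)
  have [measurable]: "f \<in> borel_measurable borel" by (intro borel_measurable_continuous_onI cont)
  have "compact (f ` S)" by (intro compact_continuous_image cont S)
  then have [measurable]: "f ` S \<in> sets borel" "S \<in> sets borel"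
    using S by (simp_all add: borel_compact)
  have "inj f"
  proof (rule injI)
    fix x y assume "f x = f y"
    then have "x \<bullet> c = y \<bullet> c" if "c \<in> Basis" for c
      using linear_orthonormal_inner[OF f that] by metis
    then show "x = y" by (rule euclidean_eqI)
  qed
  have "measure lborel (f ` S) = measure (distr lborel borel f) (f ` S)"
    by (simp add: lborel_distr_orthonormal[OF f])
  also have "\<dots> = measure lborel S"
    by (simp add: measure_distr inj_vimage_image_eq[OF \<open>inj f\<close>])
  finally show ?thesis by (simp add: measure_completion)
qed

lemma minkowski_linear_image:
  assumes "linear f"
  shows "minkowski (\<lambda>a. f ` K a) s = f ` minkowski K s"
proof (intro subset_antisym subsetI)
  have lin: "f (\<Sum>a\<in>UNIV. s a *\<^sub>R q a) = (\<Sum>a\<in>UNIV. s a *\<^sub>R f (q a))" for q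
    by (simp add: linear_sum[OF assms] linear_scale[OF assms])
  fix z
  { assume "z \<in> minkowski (\<lambda>a. f ` K a) s"
    then obtain r where z: "z = (\<Sum>a\<in>UNIV. s a *\<^sub>R r a)" and "\<forall>a. \<exists>x. x \<in> K a \<and> r a = f x"
      unfolding minkowski_def by (auto simp: image_iff Bex_def)
    then obtain q where "\<forall>a. q a \<in> K a \<and> r a = f (q a)" by metis
    with z show "z \<in> f ` minkowski K s"
      unfolding minkowski_def by (intro image_eqI[of _ _ "\<Sum>a\<in>UNIV. s a *\<^sub>R q a"]) (auto simp: lin) }
  { assume "z \<in> f ` minkowski K s"
    then obtain q where "\<forall>a. q a \<in> K a" "z = f (\<Sum>a\<in>UNIV. s a *\<^sub>R q a)" unfolding minkowski_def by auto
    then show "z \<in> minkowski (\<lambda>a. f ` K a) s"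
      unfolding minkowski_def by (intro CollectI exI[of _ "\<lambda>a. f (q a)"]) (auto simp: lin) }
qed

text \<open>The change of variables theorem of the library needs a well-ordered index type.\<close>

datatype 'a indexed = Indexed (unindexed: 'a)

instance indexed :: (finite) finite
proof
  have "(UNIV :: 'a indexed set) \<subseteq> range Indexed" by (metis indexed.exhaust rangeI subsetI)
  then show "finite (UNIV :: 'a indexed set)" by (rule finite_subset) simp
qed

instantiation indexed :: (finite) wellorder
begin

definition "x \<le> y \<longleftrightarrow> to_nat (unindexed x) \<le> to_nat (unindexed y)"
definition "x < y \<longleftrightarrow> to_nat (unindexed x) < to_nat (unindexed y)"

instance
proof
  fix P :: "'a indexed \<Rightarrow> bool" and a
  assume step: "\<And>x. (\<And>y. y < x \<Longrightarrow> P y) \<Longrightarrow> P x"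
  show "P a"
    by (rule measure_induct_rule[where f = "\<lambda>x. to_nat (unindexed x)"], rule step)
       (simp add: less_indexed_def)
next
  fix x y :: "'a indexed"
  show "x < y \<longleftrightarrow> x \<le> y \<and> \<not> y \<le> x" "x \<le> y \<or> y \<le> x"
    by (auto simp: less_eq_indexed_def less_indexed_def)
  show "x = y" if "x \<le> y" "y \<le> x"
    using that by (cases x; cases y) (simp add: less_eq_indexed_def)
qed (auto simp: less_eq_indexed_def)

end

definition flatten :: "(real^'n::finite)^'p::finite \<Rightarrow> real^('p \<times> 'n) indexed" where
  "flatten y = (\<chi> w. y $ fst (unindexed w) $ snd (unindexed w))"

lemma linear_flatten: "linear flatten"
  by (rule linearI) (simp_all add: flatten_def vec_eq_iff)

lemma flatten_axis: "flatten (axis i (axis k 1)) = axis (Indexed (i, k)) 1"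
  by (auto simp: flatten_def vec_eq_iff axis_def indexed.expand split: prod.splits)

lemma bij_betw_flatten:
  "bij_betw (flatten :: (real^'n)^'p \<Rightarrow> real^('p::finite \<times> 'n::finite) indexed) Basis Basis"
proof -
  have B: "(Basis :: ((real^'n)^'p) set) = range (\<lambda>w. axis (fst w) (axis (snd w) 1))"
    by (auto simp: Basis_vec_def intro!: image_eqI[of _ _ "(x, y)" for x y])
  have "range (Indexed :: 'p \<times> 'n \<Rightarrow> _) = UNIV" by (metis indexed.collapse surj_def)
  then have "range (\<lambda>w. axis w 1 :: real^('p \<times> 'n) indexed) = range (\<lambda>w. axis (Indexed w) 1)"
    using image_image[of "\<lambda>w. axis w 1 :: real^('p \<times> 'n) indexed" Indexed UNIV] by simp
  then have B': "(Basis :: (real^('p \<times> 'n) indexed) set) = range (\<lambda>w. axis (Indexed w) 1)"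
    by (auto simp: Basis_vec_def)
  show ?thesis
    unfolding bij_betw_def B B'
    by (auto simp: inj_on_def flatten_axis axis_eq_axis image_image)
qed

text \<open>\<open>flatten\<close> preserves volumes and, being linear, commutes with Minkowski
  combinations, so it transports the polynomial from the flat space with well-ordered
  indices.\<close>

lemma measure_minkowski:
  fixes K :: "'i::finite \<Rightarrow> ((real^'n)^'p) set"
  assumes K: "\<And>a. compact (K a)" "\<And>a. convex (K a)" "\<And>a. K a \<noteq> {}"
  obtains c :: "(('p \<times> 'n) indexed \<Rightarrow> 'i) \<Rightarrow> real" where "\<And>\<psi>. 0 \<le> c \<psi>"
    and "\<And>s. (\<And>a. 0 \<le> s a) \<Longrightarrow>
      measure lebesgue (minkowski K s) = (\<Sum>\<psi>\<in>UNIV. c \<psi> * (\<Prod>i\<in>UNIV. s (\<psi> i)))"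
proof -
  have "continuous_on A (flatten :: (real^'n)^'p \<Rightarrow> _)" for A
    by (intro linear_continuous_on) (simp add: linear_flatten flip: linear_conv_bounded_linear)
  then have K': "compact (flatten ` K a)" "convex (flatten ` K a)" "flatten ` K a \<noteq> {}" for a
    using K by (auto intro!: compact_continuous_image convex_linear_image linear_flatten)
  obtain c :: "(('p \<times> 'n) indexed \<Rightarrow> 'i) \<Rightarrow> real" where c: "\<And>\<psi>. 0 \<le> c \<psi>"
    "\<And>s. (\<And>a. 0 \<le> s a) \<Longrightarrow>
      measure lebesgue (minkowski (\<lambda>a. flatten ` K a) s) = (\<Sum>\<psi>\<in>UNIV. c \<psi> * (\<Prod>i\<in>UNIV. s (\<psi> i)))"
    using measure_minkowski_cart[of "\<lambda>a. flatten ` K a", OF K'] by blast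
  have "measure lebesgue (minkowski (\<lambda>a. flatten ` K a) s) = measure lebesgue (minkowski K s)" for s
    by (simp add: minkowski_linear_image[OF linear_flatten]
        measure_orthonormal_image[OF linear_flatten bij_betw_flatten compact_minkowski] K)
  with c show thesis by (intro that[of c]) simp_all
qed

section \<open>Mixed volumes as coefficients\<close>

text \<open>The \<open>r\<close>-th derivative of \<open>x ^ e\<close>; for \<open>r > e\<close> the truncated exponent \<open>e - r\<close> does no harm, as the
  product vanishes.\<close>

definition iter_deriv :: "nat \<Rightarrow> nat \<Rightarrow> real \<Rightarrow> real" where
  "iter_deriv e r x = (\<Prod>i<r. real e - real i) * x ^ (e - r)"

lemma iter_deriv_0: "iter_deriv e 0 x = x ^ e"
  by (simp add: iter_deriv_def)

lemma has_derivative_iter_deriv: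
  "(iter_deriv e r has_real_derivative iter_deriv e (Suc r) x) (at x within S)"
proof (cases "r < e")
  case True
  then have "(iter_deriv e r has_real_derivative
      (\<Prod>i<r. real e - real i) * (real (e - r) * x ^ (e - Suc r))) (at x within S)"
    unfolding iter_deriv_def[abs_def] by (auto intro!: derivative_eq_intros)
  moreover have "(\<Prod>i<r. real e - real i) * (real (e - r) * x ^ (e - Suc r)) = iter_deriv e (Suc r) x"
    using True by (simp add: iter_deriv_def of_nat_diff)
  ultimately show ?thesis by simp
next
  case False
  then have "iter_deriv e (Suc r) = (\<lambda>_. 0)"
    by (auto simp: iter_deriv_def fun_eq_iff intro!: bexI[of _ e])
  moreover from False have "iter_deriv e r = (\<lambda>_. \<Prod>i<r. real e - real i)"
    by (simp add: iter_deriv_def fun_eq_iff)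
  ultimately show ?thesis by simp
qed

text \<open>Evaluation at 0 singles out the exponent equal to the number of derivatives: smaller
  exponents are killed by a zero factor, larger ones by a remaining power of 0.\<close>

lemma iter_deriv_at_0: "iter_deriv e r 0 = (if e = r then fact r else 0)"
proof (cases e r rule: linorder_cases)
  case less
  then have "(\<Prod>i<r. real e - real i) = 0" by (auto intro!: bexI[of _ e])
  with less show ?thesis by (simp add: iter_deriv_def)
next
  case equal
  have "(\<Prod>i<r. real r - real i) = fact r"
  proof (induction r)
    case (Suc r)
    have "(\<Prod>i<Suc r. real (Suc r) - real i) = real (Suc r) * (\<Prod>i<r. real r - real i)"
      by (subst prod.lessThan_Suc_shift) simp
    with Suc show ?case by simp
  qed simp
  with equal show ?thesis by (simp add: iter_deriv_def)
qed (simp add: iter_deriv_def)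

text \<open>Only nonnegative \<open>t\<close> enter the one-sided derivative, so \<open>f\<close>
  may be replaced by a function \<open>g\<close> that agrees with it there.\<close>

lemma partial_deriv_eqI:
  assumes "0 \<le> s k" and "\<And>t. 0 \<le> t \<Longrightarrow> f (s(k := t)) = g t"
    and "(g has_real_derivative D) (at (s k) within {0..})"
  shows "partial_deriv k f s = D"
  unfolding partial_deriv_def
proof (rule vector_derivative_within)
  \<comment> \<open>The point must be a limit point of the half-line for the derivative to be
    unique.\<close>
  show "at (s k) within {0..} \<noteq> bot"
  proof -
    have "at_right (s k) \<le> at (s k) within {0..}"
      using assms(1) by (intro at_le) auto
    then show ?thesis
      using trivial_limit_at_right_real[of "s k"] by (metis bot.extremum_unique trivial_limit_def)
  qed
  have "((\<lambda>t. f (s(k := t))) has_real_derivative D) (at (s k) within {0..})"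
    using assms by (intro has_field_derivative_transform_within[OF assms(3), of 1]) auto
  then show "((\<lambda>t. f (s(k := t))) has_vector_derivative D) (at (s k) within {0..})"
    by (simp add: has_real_derivative_iff_has_vector_derivative)
qed

text \<open>For nonnegative \<open>s\<close> the function depends only on the sums \<sigma> over the
  positions of each body, so a derivative in the \<open>k\<close>-th parameter acts on the factor of
  \<open>b k\<close> alone and the product form persists.\<close>

lemma foldr_partial_deriv_poly:
  fixes N :: nat and b :: "nat \<Rightarrow> 'i::finite" and e :: "'k \<Rightarrow> 'i \<Rightarrow> nat"
  defines "\<sigma> \<equiv> \<lambda>s a. \<Sum>k | k < N \<and> b k = a. s k"
  assumes f: "\<And>s. (\<And>k. 0 \<le> s k) \<Longrightarrow> f s = (\<Sum>\<psi>\<in>P. c \<psi> * (\<Prod>a\<in>UNIV. \<sigma> s a ^ e \<psi> a))"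
    and "distinct ks" "set ks \<subseteq> {..<N}" and "\<And>k. 0 \<le> s k"
  shows "foldr partial_deriv ks f s =
    (\<Sum>\<psi>\<in>P. c \<psi> * (\<Prod>a\<in>UNIV. iter_deriv (e \<psi> a) (card {k \<in> set ks. b k = a}) (\<sigma> s a)))"
  using assms(3-5)
proof (induction ks arbitrary: s)
  case Nil
  then show ?case by (simp add: f iter_deriv_0)
next
  case (Cons k ks)
  let ?r = "\<lambda>a. card {k \<in> set ks. b k = a}"
  let ?rest = "\<lambda>\<psi>. \<Prod>a\<in>UNIV - {b k}. iter_deriv (e \<psi> a) (?r a) (\<sigma> s a)"
  \<comment> \<open>Replacing \<open>s k\<close> by \<open>t\<close> changes only the sum for
    \<open>b k\<close>, which becomes \<open>\<sigma> s (b k) - s k + t\<close>.\<close>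
  let ?g = "\<lambda>t. \<Sum>\<psi>\<in>P. c \<psi> * (iter_deriv (e \<psi> (b k)) (?r (b k)) (\<sigma> s (b k) - s k + t) * ?rest \<psi>)"
  have k: "k < N" "k \<notin> set ks" using Cons.prems by auto
  have \<sigma>_upd: "\<sigma> (s(k := t)) a = (if a = b k then \<sigma> s a - s k + t else \<sigma> s a)" for t a
  proof -
    have "(\<Sum>l | l < N \<and> b l = a. (s(k := t)) l) = (\<Sum>l | l < N \<and> b l = a. s l + (if l = k then t - s k else 0))"
      by (intro sum.cong) auto
    then show ?thesis using k by (simp add: \<sigma>_def sum.distrib)
  qed
  have r: "card {l \<in> set (k # ks). b l = a} = (if a = b k then Suc (?r a) else ?r a)" for a
  proof -
    have "{l \<in> set (k # ks). b l = a} = (if a = b k then insert k {l \<in> set ks. b l = a} else {l \<in> set ks. b l = a})"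
      by auto
    then show ?thesis using k by simp
  qed
  have "partial_deriv k (foldr partial_deriv ks f) s =
    (\<Sum>\<psi>\<in>P. c \<psi> * (iter_deriv (e \<psi> (b k)) (Suc (?r (b k))) (\<sigma> s (b k)) * ?rest \<psi>))"
  proof (rule partial_deriv_eqI[where g = ?g])
    show "0 \<le> s k" by fact
    fix t :: real assume "0 \<le> t"
    then have nn: "0 \<le> (s(k := t)) l" for l using Cons.prems by simp
    show "foldr partial_deriv ks f (s(k := t)) = ?g t"
      using Cons.prems
      by (subst Cons.IH[OF _ _ nn]) (auto simp: \<sigma>_upd prod.remove[of UNIV "b k"])
  next
    have "((\<lambda>t. iter_deriv e' r (x - s k + t)) has_real_derivative iter_deriv e' (Suc r) x) (at (s k) within {0..})" for e' r x
    proof -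
      have "((iter_deriv e' r \<circ> (\<lambda>t. x - s k + t)) has_real_derivative iter_deriv e' (Suc r) x * 1) (at (s k) within {0..})"
        by (rule DERIV_image_chain) (auto intro!: derivative_eq_intros has_derivative_iter_deriv simp: has_derivative_iter_deriv)
      then show ?thesis by (simp add: o_def)
    qed
    then show "(?g has_real_derivative (\<Sum>\<psi>\<in>P. c \<psi> * (iter_deriv (e \<psi> (b k)) (Suc (?r (b k))) (\<sigma> s (b k)) * ?rest \<psi>)))
        (at (s k) within {0..})"
      by (intro DERIV_sum DERIV_cmult DERIV_cmult_right)
  qed
  also have "\<dots> = (\<Sum>\<psi>\<in>P. c \<psi> * (\<Prod>a\<in>UNIV. iter_deriv (e \<psi> a) (card {l \<in> set (k # ks). b l = a}) (\<sigma> s a)))"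
    unfolding r by (simp add: prod.remove[of UNIV "b k"])
  finally show ?case by simp
qed

section \<open>Merging repeated bodies and evaluating the mixed volume\<close>

lemma scaleR_add_in_scaled:
  fixes A :: "'a::real_vector set"
  assumes "convex A" "x \<in> A" "y \<in> A" "0 \<le> u" "0 \<le> v"
  shows "u *\<^sub>R x + v *\<^sub>R y \<in> (\<lambda>x. (u + v) *\<^sub>R x) ` A"
proof (cases "u + v = 0")
  case True
  then have "u = 0" "v = 0" using assms by linarith+
  with assms show ?thesis by auto
next
  case False
  then have "(u / (u + v)) *\<^sub>R x + (v / (u + v)) *\<^sub>R y \<in> A"
    using assms by (intro convexD[OF assms(1)]) (simp_all flip: add_divide_distrib)
  moreover have "u *\<^sub>R x + v *\<^sub>R y = (u + v) *\<^sub>R ((u / (u + v)) *\<^sub>R x + (v / (u + v)) *\<^sub>R y)"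
    using False by (simp add: scaleR_add_right)
  ultimately show ?thesis by blast
qed

text \<open>Convexity gives uA + vA = (u + v)A for nonnegative u and v, so repeated copies of a body
  act as one copy with the summed parameter. For an empty index set both sides are {0}, as
  \<open>A\<close> is nonempty.\<close>

lemma sum_scale_convex:
  fixes A :: "'a::real_vector set"
  assumes "convex A" "A \<noteq> {}" "finite S" "\<And>k. k \<in> S \<Longrightarrow> 0 \<le> s k"
  shows "(\<Sum>k\<in>S. (\<lambda>x. s k *\<^sub>R x) ` A) = (\<lambda>x. (\<Sum>k\<in>S. s k) *\<^sub>R x) ` A"
  using assms(3,4)
proof (induction S)
  case empty
  then show ?case using assms(2) by auto
next
  case (insert k S)
  have "0 \<le> s k" "0 \<le> sum s S" using insert by (auto intro: sum_nonneg)
  then have "(\<lambda>x. s k *\<^sub>R x) ` A + (\<lambda>x. sum s S *\<^sub>R x) ` A = (\<lambda>x. (s k + sum s S) *\<^sub>R x) ` A"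
    using scaleR_add_in_scaled[OF assms(1)]
    by (auto simp: scaleR_add_left intro: set_plus_intro elim!: set_plus_elim)
  with insert show ?case by simp
qed

text \<open>Merging equal bodies makes the volume a polynomial in the sums \<sigma>. One derivative
  per list entry, taken at 0, keeps exactly the monomials whose exponents are the multiplicities and
  produces their factorials.\<close>

lemma mixed_volume_map:
  fixes A :: "'i::finite \<Rightarrow> 'a::euclidean_space set" and c :: "('m::finite \<Rightarrow> 'i) \<Rightarrow> real"
  assumes A: "\<And>a. convex (A a)" "\<And>a. A a \<noteq> {}"
    and c: "\<And>s. (\<And>a. 0 \<le> s a) \<Longrightarrow>
      measure lebesgue (minkowski A s) = (\<Sum>\<psi>\<in>UNIV. c \<psi> * (\<Prod>i\<in>UNIV. s (\<psi> i)))"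
  shows "mixed_volume (map A bs) = (\<Prod>a\<in>UNIV. fact (count_list bs a)) / fact (length bs) *
    (\<Sum>\<psi> | \<forall>a. card {i. \<psi> i = a} = count_list bs a. c \<psi>)"
proof -
  let ?N = "length bs"
  define \<sigma> where "\<sigma> s a = (\<Sum>k | k < ?N \<and> bs ! k = a. s k)" for s :: "nat \<Rightarrow> real" and a
  define e where "e \<psi> a = card {i. \<psi> i = a}" for \<psi> :: "'m \<Rightarrow> 'i" and a
  have count: "count_list bs a = card {k. k < ?N \<and> bs ! k = a}" for a
    by (simp add: count_list_eq_length_filter length_filter_conv_card eq_commute)
  have poly: "volume_combination (map A bs) s = (\<Sum>\<psi>\<in>UNIV. c \<psi> * (\<Prod>a\<in>UNIV. \<sigma> s a ^ e \<psi> a))"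
    if s: "\<And>k. 0 \<le> s k" for s
  proof -
    have "(\<Sum>k<?N. (\<lambda>x. s k *\<^sub>R x) ` (map A bs ! k)) = (\<Sum>k<?N. (\<lambda>x. s k *\<^sub>R x) ` A (bs ! k))"
      by (intro sum.cong) auto
    also have "\<dots> = (\<Sum>a\<in>UNIV. \<Sum>k\<in>{k\<in>{..<?N}. bs ! k = a}. (\<lambda>x. s k *\<^sub>R x) ` A (bs ! k))"
      by (rule sum.group[symmetric]) auto
    also have "\<dots> = (\<Sum>a\<in>UNIV. \<Sum>k\<in>{k. k < ?N \<and> bs ! k = a}. (\<lambda>x. s k *\<^sub>R x) ` A a)"
      by (intro sum.cong) auto
    also have "\<dots> = minkowski A (\<sigma> s)"
      unfolding minkowski_eq_sum \<sigma>_def by (intro sum.cong refl sum_scale_convex A s) simp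
    finally have "volume_combination (map A bs) s = measure lebesgue (minkowski A (\<sigma> s))"
      by (simp add: volume_combination_def)
    moreover have "\<dots> = (\<Sum>\<psi>\<in>UNIV. c \<psi> * (\<Prod>i\<in>UNIV. \<sigma> s (\<psi> i)))"
      by (rule c) (auto simp: \<sigma>_def intro: sum_nonneg s)
    moreover have "(\<Prod>i\<in>UNIV. \<sigma> s (\<psi> i)) = (\<Prod>a\<in>UNIV. \<sigma> s a ^ e \<psi> a)" for \<psi> :: "'m \<Rightarrow> 'i"
    proof -
      have "(\<Prod>i\<in>UNIV. \<sigma> s (\<psi> i)) = (\<Prod>a\<in>UNIV. \<Prod>i\<in>{i\<in>UNIV. \<psi> i = a}. \<sigma> s (\<psi> i))"
        by (rule prod.group[symmetric]) auto
      then show ?thesis by (simp add: e_def)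
    qed
    ultimately show ?thesis by simp
  qed
  have "foldr partial_deriv [0..<?N] (volume_combination (map A bs)) (\<lambda>_. 0) =
    (\<Sum>\<psi>\<in>UNIV. c \<psi> * (\<Prod>a\<in>UNIV. iter_deriv (e \<psi> a) (card {k \<in> set [0..<?N]. bs ! k = a}) (\<sigma> (\<lambda>_. 0) a)))"
    using foldr_partial_deriv_poly[where N = ?N and b = "(!) bs" and ks = "[0..<?N]" and s = "\<lambda>_. 0"
        and f = "volume_combination (map A bs)" and P = UNIV and c = c and e = e] poly
    unfolding \<sigma>_def by (simp add: lessThan_atLeast0)
  also have "\<dots> = (\<Sum>\<psi>\<in>UNIV. c \<psi> * (\<Prod>a\<in>UNIV. if e \<psi> a = count_list bs a then fact (count_list bs a) else 0))"
    by (simp add: \<sigma>_def iter_deriv_at_0 count cong: if_cong)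
  also have "\<dots> = (\<Sum>\<psi>\<in>UNIV. if \<forall>a. e \<psi> a = count_list bs a then c \<psi> * (\<Prod>a\<in>UNIV. fact (count_list bs a)) else 0)"
    by (intro sum.cong refl) auto
  also have "\<dots> = (\<Prod>a\<in>UNIV. fact (count_list bs a)) * (\<Sum>\<psi> | \<forall>a. e \<psi> a = count_list bs a. c \<psi>)"
    by (simp add: sum.If_cases sum_distrib_left mult.commute)
  finally show ?thesis by (simp add: mixed_volume_def e_def)
qed

section \<open>The Rogers--Shephard type inequality\<close>

lemma prod_UNIV_option:
  fixes g :: "'p::finite option \<Rightarrow> 'b::comm_monoid_mult"
  shows "(\<Prod>a\<in>UNIV. g a) = g None * (\<Prod>i\<in>UNIV. g (Some i))"
  by (simp add: UNIV_option_conv prod.reindex)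

lemma sum_UNIV_option:
  fixes g :: "'p::finite option \<Rightarrow> 'b::comm_monoid_add"
  shows "(\<Sum>a\<in>UNIV. g a) = g None + (\<Sum>i\<in>UNIV. g (Some i))"
  by (simp add: UNIV_option_conv sum.reindex)

lemma measurable_vec_lambda_PiM [measurable]:
  "(\<lambda>f. \<chi> i. f i) \<in> (\<Pi>\<^sub>M i\<in>(UNIV :: 'p::finite set). (lborel :: 'a::euclidean_space measure)) \<rightarrow>\<^sub>M borel"
proof (subst borel_measurable_euclidean_space, safe)
  fix b :: "'a^'p" assume "b \<in> Basis"
  then obtain i u where b: "b = axis i u" by (auto simp: Basis_vec_def)
  show "(\<lambda>f. (\<chi> i. f i) \<bullet> b) \<in> borel_measurable (\<Pi>\<^sub>M i\<in>UNIV. lborel)"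
    unfolding b by (simp add: inner_axis)
qed

text \<open>Both measures agree on boxes: the basis of the vector space consists of pairs of a
  coordinate and a basis vector, so the product of the side lengths splits.\<close>

lemma lborel_vec:
  "distr (\<Pi>\<^sub>M i\<in>(UNIV :: 'p::finite set). (lborel :: 'a::euclidean_space measure)) borel (\<lambda>f. \<chi> i. f i) = lborel"
proof (rule lborel_eqI[symmetric])
  interpret product_sigma_finite "\<lambda>_::'p. lborel :: 'a measure" ..
  fix l u :: "'a^'p" assume le: "\<And>b. b \<in> Basis \<Longrightarrow> l \<bullet> b \<le> u \<bullet> b"
  have le': "l $ i \<bullet> b \<le> u $ i \<bullet> b" if "b \<in> Basis" for i b
    using le[of "axis i b"] that by (simp add: inner_axis Basis_vec_def) blast
  have "(\<lambda>f. \<chi> i. f i) -` box l u \<inter> space (\<Pi>\<^sub>M i\<in>(UNIV :: 'p set). (lborel :: 'a measure)) =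
      Pi\<^sub>E UNIV (\<lambda>i. box (l $ i) (u $ i))"
    by (auto simp: box_def Basis_vec_def inner_axis space_PiM PiE_UNIV_domain)
  then have "emeasure (distr (\<Pi>\<^sub>M i\<in>(UNIV :: 'p set). (lborel :: 'a measure)) borel (\<lambda>f. \<chi> i. f i)) (box l u) =
      (\<Prod>i\<in>UNIV. emeasure lborel (box (l $ i) (u $ i)))"
    by (simp add: emeasure_distr emeasure_PiM)
  also have "\<dots> = (\<Prod>i\<in>UNIV. \<Prod>b\<in>Basis. ennreal ((u - l) $ i \<bullet> b))"
    using le' by (simp add: emeasure_lborel_box prod_ennreal[symmetric] inner_diff_left)
  also have "\<dots> = (\<Prod>b\<in>Basis. ennreal ((u - l) \<bullet> b))"
  proof -
    have "(\<Prod>i\<in>UNIV. \<Prod>b\<in>Basis. ennreal ((u - l) $ i \<bullet> b)) =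
        (\<Prod>(i, b)\<in>UNIV \<times> Basis. ennreal ((u - l) \<bullet> axis i b))"
      by (subst prod.cartesian_product) (simp add: inner_axis)
    also have "\<dots> = (\<Prod>b\<in>(\<lambda>(i, b). axis i b) ` (UNIV \<times> Basis). ennreal ((u - l) \<bullet> b))"
      by (subst prod.reindex) (auto simp: inj_on_def axis_eq_axis case_prod_beta)
    also have "(\<lambda>(i, b). axis i b) ` (UNIV \<times> Basis) = (Basis :: ('a^'p) set)"
      by (auto simp: Basis_vec_def)
    finally show ?thesis .
  qed
  also have "\<dots> = ennreal (\<Prod>b\<in>Basis. (u - l) \<bullet> b)"
    using le by (intro prod_ennreal) (simp add: inner_diff_left)
  finally show "emeasure (distr (\<Pi>\<^sub>M i\<in>(UNIV :: 'p set). (lborel :: 'a measure)) borel (\<lambda>f. \<chi> i. f i)) (box l u) =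
      ennreal (\<Prod>b\<in>Basis. (u - l) \<bullet> b)" .
qed simp

lemma borel_measurable_vec_nth [measurable]: "(\<lambda>x::'a::euclidean_space^'p::finite. x $ i) \<in> borel_measurable borel"
  by (intro borel_measurable_continuous_onI continuous_intros)

lemma emeasure_lborel_vec:
  fixes B :: "'p::finite \<Rightarrow> 'a::euclidean_space set"
  assumes [measurable]: "\<And>i. B i \<in> sets borel"
  shows "emeasure lborel {z. \<forall>i. z $ i \<in> B i} = (\<Prod>i\<in>UNIV. emeasure lborel (B i))"
proof -
  interpret product_sigma_finite "\<lambda>_::'p. lborel :: 'a measure" ..
  have [measurable]: "{z. \<forall>i. z $ i \<in> B i} \<in> sets borel" by measurable
  have "emeasure lborel {z. \<forall>i. z $ i \<in> B i} =
      emeasure (distr (\<Pi>\<^sub>M i\<in>(UNIV :: 'p set). (lborel :: 'a measure)) borel (\<lambda>f. \<chi> i. f i)) {z. \<forall>i. z $ i \<in> B i}"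
    by (simp add: lborel_vec)
  also have "\<dots> = emeasure (\<Pi>\<^sub>M i\<in>(UNIV :: 'p set). (lborel :: 'a measure)) (Pi\<^sub>E UNIV B)"
    by (subst emeasure_distr) (auto intro!: arg_cong2[where f = emeasure] simp: space_PiM PiE_UNIV_domain)
  finally show ?thesis by (simp add: emeasure_PiM)
qed

lemma nn_integral_vec_prod:
  fixes f :: "'q::finite \<Rightarrow> real \<Rightarrow> ennreal"
  assumes [measurable]: "\<And>a. f a \<in> borel_measurable borel"
  shows "(\<integral>\<^sup>+v. (\<Prod>a\<in>UNIV. f a (v $ a)) \<partial>lborel) = (\<Prod>a\<in>UNIV. \<integral>\<^sup>+x. f a x \<partial>lborel)"
proof -
  interpret product_sigma_finite "\<lambda>_::'q. lborel :: real measure" ..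
  have "(\<integral>\<^sup>+v. (\<Prod>a\<in>UNIV. f a (v $ a)) \<partial>lborel) =
      (\<integral>\<^sup>+v. (\<Prod>a\<in>UNIV. f a (v $ a)) \<partial>distr (\<Pi>\<^sub>M a\<in>(UNIV :: 'q set). (lborel :: real measure)) borel (\<lambda>f. \<chi> i. f i))"
    by (simp add: lborel_vec)
  also have "\<dots> = (\<integral>\<^sup>+v. (\<Prod>a\<in>UNIV. f a (v a)) \<partial>(\<Pi>\<^sub>M a\<in>(UNIV :: 'q set). (lborel :: real measure)))"
    by (subst nn_integral_distr) auto
  finally show ?thesis by (simp add: product_nn_integral_prod)
qed

text \<open>After translation by \<open>r\<close> the integrand is a multiple of the Erlang density;
  the factor \<open>x ^ 0\<close> makes the integral its moment of order 0, which is 1.\<close>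

lemma nn_integral_power_exp_shift:
  fixes r l :: real
  assumes l: "0 < l"
  shows "(\<integral>\<^sup>+x. ennreal ((x - r) ^ k * exp (- l * x)) * indicator {r..} x \<partial>lborel) =
    ennreal (fact k / l ^ Suc k * exp (- l * r))"
proof -
  have "(\<integral>\<^sup>+x. ennreal ((x - r) ^ k * exp (- l * x)) * indicator {r..} x \<partial>lborel) =
      (\<integral>\<^sup>+x. ennreal ((r + 1 * x - r) ^ k * exp (- l * (r + 1 * x))) * indicator {r..} (r + 1 * x) \<partial>lborel)"
    by (subst nn_integral_real_affine[of _ 1 r]) auto
  also have "\<dots> = (\<integral>\<^sup>+x. ennreal (fact k / l ^ Suc k * exp (- l * r)) * ennreal (erlang_density k l x * x ^ 0) \<partial>lborel)"
  proof (intro nn_integral_cong)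
    fix x :: real
    have "exp (- l * (r + x)) = exp (- l * r) * exp (- l * x)"
      by (simp add: algebra_simps flip: exp_add)
    then have "x ^ k * exp (- l * (r + x)) =
        fact k / l ^ Suc k * exp (- l * r) * (l ^ Suc k * x ^ k * exp (- l * x) / fact k)"
      using l by simp
    then show "ennreal ((r + 1 * x - r) ^ k * exp (- l * (r + 1 * x))) * indicator {r..} (r + 1 * x) =
        ennreal (fact k / l ^ Suc k * exp (- l * r)) * ennreal (erlang_density k l x * x ^ 0)"
      using l by (auto simp: erlang_density_def indicator_def simp flip: ennreal_mult)
  qed
  also have "\<dots> = ennreal (fact k / l ^ Suc k * exp (- l * r)) * (\<integral>\<^sup>+x. ennreal (erlang_density k l x * x ^ 0) \<partial>lborel)"
    by (intro nn_integral_cmult) simp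
  also have "\<dots> = ennreal (fact k / l ^ Suc k * exp (- l * r))"
    by (subst nn_integral_erlang_ith_moment[OF l]) simp
  finally show ?thesis .
qed

section \<open>The bodies in W and the fibers of the difference map\<close>

definition bodies :: "(real^'n) set \<Rightarrow> 'p option \<Rightarrow> ((real^'n)^'p) set" where
  "bodies K a = (case a of None \<Rightarrow> uminus ` diag_emb ` K | Some i \<Rightarrow> factor_incl i ` K)"

text \<open>For dilates \<open>S a\<close> of \<open>K\<close> by \<open>s a\<close>, this is the
  intersection of the dilate for \<open>None\<close> with the other dilates translated by
  \<open>- z $ i\<close>.\<close>

definition fiber :: "('p option \<Rightarrow> 'a::plus set) \<Rightarrow> 'a^'p \<Rightarrow> 'a set" where
  "fiber S z = {y \<in> S None. \<forall>i. y + z $ i \<in> S (Some i)}"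

lemma linear_bodies:
  obtains f :: "real^'n \<Rightarrow> (real^'n)^'p" where "linear f" "\<And>K. bodies K a = f ` K"
proof (cases a)
  case None
  have "linear (\<lambda>x. - diag_emb x :: (real^'n)^'p)"
    by (rule linearI) (simp_all add: diag_emb_def vec_eq_iff)
  then show ?thesis by (rule that) (simp add: bodies_def None image_image)
next
  case (Some i)
  have "linear (factor_incl i :: real^'n \<Rightarrow> (real^'n)^'p)"
    by (rule linearI) (simp_all add: factor_incl_def vec_eq_iff axis_def)
  then show ?thesis by (rule that) (simp add: bodies_def Some)
qed

lemma bodies_convex_body:
  fixes K :: "(real^'n) set" and a :: "'p::finite option"
  assumes "convex_body K"
  shows "compact (bodies K a :: ((real^'n)^'p) set)" "convex (bodies K a :: ((real^'n)^'p) set)"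
    "bodies K a \<noteq> ({} :: ((real^'n)^'p) set)"
proof -
  obtain f :: "real^'n \<Rightarrow> (real^'n)^'p" where f: "linear f" "\<And>K. bodies K a = f ` K"
    using linear_bodies[of a] by metis
  then have "continuous_on K f"
    by (intro linear_continuous_on) (simp add: linear_conv_bounded_linear)
  with f assms show "compact (bodies K a :: ((real^'n)^'p) set)" "convex (bodies K a :: ((real^'n)^'p) set)"
    "bodies K a \<noteq> ({} :: ((real^'n)^'p) set)"
    by (auto simp: convex_body_def compact_continuous_image convex_linear_image)
qed

lemma minkowski_bodiesE:
  fixes z :: "(real^'n)^'p::finite"
  assumes "z \<in> minkowski (bodies K) s"
  obtains y x where "y \<in> K" "\<And>i. x i \<in> K"
    "\<And>i. z $ i = s (Some i) *\<^sub>R x i - s None *\<^sub>R y"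
proof -
  obtain q where q: "\<And>a. q a \<in> bodies K a" and z: "z = (\<Sum>a\<in>UNIV. s a *\<^sub>R q a)"
    using assms unfolding minkowski_def by blast
  obtain y where y: "y \<in> K" "q None = - diag_emb y"
    using q[of None] by (auto simp: bodies_def)
  have "\<exists>x. x \<in> K \<and> q (Some i) = axis i x" for i
    using q[of "Some i"] by (auto simp: bodies_def factor_incl_def)
  then obtain x where x: "\<And>i. x i \<in> K" "\<And>i. q (Some i) = axis i (x i)" by metis
  have "z $ i = s (Some i) *\<^sub>R x i - s None *\<^sub>R y" for i
  proof -
    have "(\<Sum>j\<in>UNIV. s (Some j) *\<^sub>R axis j (x j) $ i) = (\<Sum>j\<in>UNIV. if j = i then s (Some i) *\<^sub>R x i else 0)"
      by (intro sum.cong) (auto simp: axis_def)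
    then show ?thesis
      by (simp add: z sum_UNIV_option y x diag_emb_def)
  qed
  with y x show thesis by (intro that[of y x])
qed

text \<open>Tonelli for the indicator \<open>f\<close>: with \<open>y\<close> fixed, the conditions
  on the blocks of \<open>z\<close> are independent, and each defines a translate of
  \<open>S (Some i)\<close>.\<close>

lemma nn_integral_fiber:
  fixes S :: "'p::finite option \<Rightarrow> 'a::euclidean_space set"
  assumes [measurable]: "\<And>a. S a \<in> sets borel"
  shows "(\<integral>\<^sup>+z. emeasure lborel (fiber S z) \<partial>lborel) = (\<Prod>a\<in>UNIV. emeasure lborel (S a))"
proof -
  define f :: "'a^'p \<Rightarrow> 'a \<Rightarrow> ennreal"
    where "f z y = indicator (S None) y * (\<Prod>i\<in>UNIV. indicator (S (Some i)) (y + z $ i))" for z y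
  have meas: "case_prod f \<in> borel_measurable (lborel \<Otimes>\<^sub>M lborel)"
    unfolding f_def by measurable
  have all: "(\<Prod>i\<in>UNIV. indicator (A i) (x i) :: ennreal) = (if \<forall>i. x i \<in> A i then 1 else 0)"
    for A :: "'p \<Rightarrow> 'a set" and x by (auto simp: indicator_def)
  have fiber: "emeasure lborel (fiber S z) = (\<integral>\<^sup>+y. f z y \<partial>lborel)" for z
  proof -
    have "fiber S z \<in> sets borel" unfolding fiber_def by measurable
    moreover have "f z y = indicator (fiber S z) y" for y
      by (auto simp: f_def fiber_def all indicator_def)
    ultimately show ?thesis by simp
  qed
  have inner: "(\<integral>\<^sup>+z. f z y \<partial>lborel) = indicator (S None) y * (\<Prod>i\<in>UNIV. emeasure lborel (S (Some i)))" for y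
  proof -
    have "{z. \<forall>i. y + z $ i \<in> S (Some i)} \<in> sets borel" by measurable
    moreover have "f z y = indicator (S None) y * indicator {z. \<forall>i. y + z $ i \<in> S (Some i)} z" for z
      by (auto simp: f_def all indicator_def)
    ultimately have "(\<integral>\<^sup>+z. f z y \<partial>lborel) = indicator (S None) y * emeasure lborel {z. \<forall>i. z $ i \<in> {x. y + x \<in> S (Some i)}}"
      by (simp add: nn_integral_cmult_indicator)
    also have "emeasure lborel {z :: 'a^'p. \<forall>i. z $ i \<in> {x. y + x \<in> S (Some i)}} =
        (\<Prod>i\<in>UNIV. emeasure lborel {x. y + x \<in> S (Some i)})"
      by (rule emeasure_lborel_vec) measurable
    moreover have "emeasure lborel {x. y + x \<in> S (Some i)} = emeasure lborel (S (Some i))" for i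
    proof -
      have "emeasure lborel (S (Some i)) = emeasure (distr lborel borel ((+) y)) (S (Some i))"
        by (simp add: lborel_distr_plus)
      then show ?thesis by (simp add: emeasure_distr vimage_def)
    qed
    ultimately show ?thesis by simp
  qed
  have "(\<integral>\<^sup>+z. emeasure lborel (fiber S z) \<partial>lborel) = (\<integral>\<^sup>+y. (\<integral>\<^sup>+z. f z y \<partial>lborel) \<partial>lborel)"
    unfolding fiber
    by (rule pair_sigma_finite.Fubini'[OF pair_sigma_finite.intro meas, symmetric]) (rule sigma_finite_lborel)+
  also have "\<dots> = emeasure lborel (S None) * (\<Prod>i\<in>UNIV. emeasure lborel (S (Some i)))"
    unfolding inner by (simp add: nn_integral_multc)
  finally show ?thesis by (simp add: prod_UNIV_option)
qed

text \<open>If \<^term>\<open>z\<close> is already reached with the smaller factors \<^term>\<open>s a - r\<close>, then its fiber contains a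
  translate of \<^term>\<open>r\<close> times the body.\<close>

lemma measure_fiber_ge:
  fixes K :: "(real^'n) set" and z :: "(real^'n)^'p::finite"
  assumes K: "convex_body K" and z: "z \<in> minkowski (bodies K) (\<lambda>a. s a - r)"
    and r: "0 \<le> r" "\<And>a. r \<le> s a"
  shows "r ^ CARD('n) * measure lebesgue K \<le> measure lebesgue (fiber (\<lambda>a. (\<lambda>x. s a *\<^sub>R x) ` K) z)"
proof -
  let ?G = "fiber (\<lambda>a. (\<lambda>x. s a *\<^sub>R x) ` K) z"
  have K': "compact K" "convex K" using K by (auto simp: convex_body_def)
  obtain y x where y: "y \<in> K" and x: "\<And>i. x i \<in> K"
      and zi: "\<And>i. z $ i = (s (Some i) - r) *\<^sub>R x i - (s None - r) *\<^sub>R y"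
    using minkowski_bodiesE[OF z] by metis
  \<comment> \<open>By convexity these points lie in the dilate of \<open>K\<close> by
    \<open>s None\<close>. Adding \<open>z $ i\<close> cancels the term in \<open>y\<close> and
    leaves \<open>r *\<^sub>R k + (s (Some i) - r) *\<^sub>R x i\<close>, which lies in the dilate
    by \<open>s (Some i)\<close>.\<close>
  have sub: "(\<lambda>k. r *\<^sub>R k + (s None - r) *\<^sub>R y) ` K \<subseteq> ?G"
  proof (rule image_subsetI)
    fix k assume k: "k \<in> K"
    have "r *\<^sub>R k + (s None - r) *\<^sub>R y \<in> (\<lambda>x. (r + (s None - r)) *\<^sub>R x) ` K"
      using r by (intro scaleR_add_in_scaled K' k y) auto
    moreover have "r *\<^sub>R k + (s (Some i) - r) *\<^sub>R x i \<in> (\<lambda>x. (r + (s (Some i) - r)) *\<^sub>R x) ` K" for i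
      using r by (intro scaleR_add_in_scaled K' k x) auto
    ultimately show "r *\<^sub>R k + (s None - r) *\<^sub>R y \<in> ?G"
      by (simp add: fiber_def zi)
  qed
  have "bounded ?G"
    by (rule bounded_subset[of "(\<lambda>x. s None *\<^sub>R x) ` K"])
       (auto simp: fiber_def intro!: compact_imp_bounded compact_scaling K')
  moreover have "closed ?G"
  proof -
    have c: "closed ((\<lambda>x. s a *\<^sub>R x) ` K)" for a by (intro compact_imp_closed compact_scaling K')
    have "?G = (\<lambda>x. s None *\<^sub>R x) ` K \<inter> (\<Inter>i. (\<lambda>y. y + z $ i) -` (\<lambda>x. s (Some i) *\<^sub>R x) ` K)"
      by (auto simp: fiber_def)
    then show ?thesis
      by (auto intro!: closed_Int closed_INT closed_vimage c continuous_intros)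
  qed
  ultimately have "compact ?G" by (simp add: compact_eq_bounded_closed)
  then have "measure lebesgue ((\<lambda>k. r *\<^sub>R k + (s None - r) *\<^sub>R y) ` K) \<le> measure lebesgue ?G"
    using sub lmeasurable_compact[OF compact_affinity[OF K'(1), of "(s None - r) *\<^sub>R y" r]]
    by (intro measure_mono_fmeasurable) (auto simp: lmeasurable_compact add.commute fmeasurableD)
  moreover have "measure lebesgue ((\<lambda>k. r *\<^sub>R k + (s None - r) *\<^sub>R y) ` K) = r ^ CARD('n) * measure lebesgue K"
    using r by (simp add: measure_lebesgue_affine)
  ultimately show ?thesis by simp
qed

section \<open>The integral inequality for the volume and its coefficients\<close>

lemma compact_vec_box:
  fixes A :: "'q::finite \<Rightarrow> 'a::euclidean_space set"
  assumes "\<And>a. compact (A a)"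
  shows "compact {q. \<forall>a. q $ a \<in> A a}"
  unfolding compact_eq_bounded_closed
proof
  have "bounded (\<Union>a. A a)" by (intro bounded_UN ballI compact_imp_bounded assms) simp
  then obtain B where B: "\<And>a x. x \<in> A a \<Longrightarrow> norm x \<le> B" unfolding bounded_iff by blast
  have "norm q \<le> (\<Sum>a\<in>(UNIV :: 'q set). B)" if "\<forall>a. q $ a \<in> A a" for q :: "'a^'q"
  proof -
    have "norm q \<le> (\<Sum>a\<in>UNIV. norm (q $ a))" unfolding norm_vec_def by (rule L2_set_le_sum) simp
    also have "\<dots> \<le> (\<Sum>a\<in>(UNIV :: 'q set). B)" using B that by (intro sum_mono) auto
    finally show ?thesis .
  qed
  then show "bounded {q. \<forall>a. q $ a \<in> A a}" unfolding bounded_iff by blast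
  have "{q. \<forall>a. q $ a \<in> A a} = (\<Inter>a. (\<lambda>q. q $ a) -` A a)" by auto
  then show "closed {q. \<forall>a. q $ a \<in> A a}"
    by (simp only:) (intro closed_INT ballI closed_vimage compact_imp_closed assms continuous_intros)
qed

text \<open>A continuous image of a compact product. Compactness supplies the joint measurability in
  \<open>(r, z)\<close> that Tonelli requires.\<close>

lemma compact_minkowski_graph:
  fixes A :: "'q::finite \<Rightarrow> 'a::euclidean_space set"
  assumes "\<And>a. compact (A a)"
  shows "compact {(r, z). r \<in> {0..m::real} \<and> z \<in> minkowski A (\<lambda>a. s a - r)}"
proof -
  have "{(r, z). r \<in> {0..m} \<and> z \<in> minkowski A (\<lambda>a. s a - r)} =
      (\<lambda>(r, q). (r, \<Sum>a\<in>UNIV. (s a - r) *\<^sub>R q $ a)) ` ({0..m} \<times> {q. \<forall>a. q $ a \<in> A a})" (is "?L = ?R")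
  proof (intro subset_antisym subsetI)
    fix w assume "w \<in> ?L"
    then obtain r q where w: "r \<in> {0..m}" "\<forall>a. q a \<in> A a" "w = (r, \<Sum>a\<in>UNIV. (s a - r) *\<^sub>R q a)"
      by (auto simp: minkowski_def)
    then show "w \<in> ?R" by (intro image_eqI[of _ _ "(r, \<chi> a. q a)"]) auto
  next
    fix w assume "w \<in> ?R"
    then obtain r q where w: "r \<in> {0..m}" "\<forall>a. q $ a \<in> A a" "w = (r, \<Sum>a\<in>UNIV. (s a - r) *\<^sub>R q $ a)"
      by auto
    then show "w \<in> ?L" by (auto simp: minkowski_def)
  qed
  moreover have "compact ?R"
    by (intro compact_continuous_image compact_Times compact_vec_box assms)
       (auto simp: case_prod_beta intro!: continuous_intros)
  ultimately show ?thesis by simp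
qed

lemma emeasure_scaled:
  fixes K :: "'a::euclidean_space set"
  assumes "compact K" "0 \<le> t"
  shows "emeasure lborel ((\<lambda>x. t *\<^sub>R x) ` K) = ennreal (t ^ DIM('a) * measure lebesgue K)"
proof -
  have "emeasure lborel ((\<lambda>x. t *\<^sub>R x) ` K) = emeasure lebesgue ((\<lambda>x. t *\<^sub>R x) ` K)"
    using assms by (simp add: borel_compact compact_scaling)
  also have "\<dots> = ennreal (t ^ DIM('a)) * emeasure lebesgue K"
    using emeasure_lebesgue_affine[of t 0 K] assms by (simp add: ennreal_power)
  also have "emeasure lebesgue K = ennreal (measure lebesgue K)"
    using fmeasurableD2[OF lmeasurable_compact[OF assms(1)]] by (simp add: emeasure_eq_ennreal_measure)
  finally show ?thesis using assms by (simp add: ennreal_mult)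
qed

text \<open>Tonelli for the weight n r^(n-1) on pairs \<open>(r, z)\<close> with \<open>z\<close> in
  the combination of parameters \<open>s a - r\<close>. Integrating over \<open>z\<close> first
  gives the left side; integrating over \<open>r\<close> first gives at most the fiber volume
  divided by |K|, and the fiber volumes integrate to the product of the volumes of the
  dilates.\<close>

lemma nn_integral_minkowski_le:
  fixes K :: "(real^'n) set" and s :: "'p::finite option \<Rightarrow> real"
  assumes K: "convex_body K" "0 < measure lebesgue K" and s: "\<And>a. 0 \<le> s a"
  defines "m \<equiv> Min (range s)"
  shows "(\<integral>\<^sup>+(r::real). ennreal (CARD('n) * r ^ (CARD('n) - 1)) * indicator {0..m} r *
      ennreal (measure lebesgue (minkowski (bodies K :: _ \<Rightarrow> ((real^'n)^'p) set) (\<lambda>a. s a - r))) \<partial>lborel)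
    \<le> ennreal (measure lebesgue K ^ CARD('p) * (\<Prod>a\<in>UNIV. s a ^ CARD('n)))"
proof -
  let ?n = "CARD('n)" and ?k = "measure lebesgue K"
  let ?M = "\<lambda>r :: real. minkowski (bodies K :: _ \<Rightarrow> ((real^'n)^'p) set) (\<lambda>a. s a - r)"
  define S where "S a = (\<lambda>x. s a *\<^sub>R x) ` K" for a
  define \<Gamma> where "\<Gamma> = {(r :: real, z). r \<in> {0..m} \<and> z \<in> ?M r}"
  define h where "h r z = ennreal (?n * r ^ (?n - 1)) * indicator \<Gamma> (r, z)" for r :: real and z
  have cK: "compact K" using K by (simp add: convex_body_def)
  have n: "?n > 0" by simp
  have [measurable]: "\<Gamma> \<in> sets borel"
    unfolding \<Gamma>_def by (intro borel_compact compact_minkowski_graph bodies_convex_body K)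
  have [measurable]: "S a \<in> sets borel" for a
    unfolding S_def by (intro borel_compact compact_scaling cK)
  have meas: "case_prod h \<in> borel_measurable (lborel \<Otimes>\<^sub>M lborel)"
  proof -
    have "(\<lambda>w :: real \<times> ((real^'n)^'p). ennreal (?n * fst w ^ (?n - 1)) * indicator \<Gamma> w) \<in> borel_measurable borel"
      by (intro borel_measurable_times_ennreal borel_measurable_indicator measurable_compose[OF _ measurable_ennreal]
          borel_measurable_continuous_onI) (auto intro!: continuous_intros)
    moreover have "case_prod h = (\<lambda>w :: real \<times> ((real^'n)^'p). ennreal (?n * fst w ^ (?n - 1)) * indicator \<Gamma> w)"
      by (simp add: fun_eq_iff h_def)
    ultimately show ?thesis by (simp add: lborel_prod)
  qed
  have [measurable]: "?M r \<in> sets borel" for r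
    by (intro borel_compact compact_minkowski bodies_convex_body K)
  have m: "r \<le> m \<longleftrightarrow> (\<forall>a. r \<le> s a)" for r by (simp add: m_def)
  have emS: "emeasure lborel (S a) = ennreal (s a ^ ?n * ?k)" for a
    unfolding S_def by (subst emeasure_scaled) (auto simp: cK s)
  have col: "(\<integral>\<^sup>+r. h r z \<partial>lborel) \<le> emeasure lborel (fiber S z) * ennreal (1 / ?k)" for z
  proof -
    have fin: "emeasure lborel (fiber S z) = ennreal (measure lebesgue (fiber S z))"
    proof -
      have b: "fiber S z \<in> sets borel" unfolding fiber_def by measurable
      have "emeasure lborel (fiber S z) \<le> emeasure lborel (S None)"
        by (intro emeasure_mono) (auto simp: fiber_def)
      then have "emeasure lborel (fiber S z) \<noteq> \<infinity>" by (simp add: emS top_unique) (metis ennreal_neq_top top_unique)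
      then show ?thesis using b by (simp add: emeasure_eq_ennreal_measure measure_completion)
    qed
    define g where "g = measure lebesgue (fiber S z)"
    \<comment> \<open>The largest \<open>r\<close> with r^n |K| at most \<open>g\<close>; the weight
      n r^(n-1) then integrates over \<open>{0..R}\<close> to exactly R^n = g / |K|.\<close>
    define R where "R = root ?n (g / ?k)"
    have gk: "0 \<le> g / ?k" using K(2) by (simp add: g_def)
    then have R: "0 \<le> R" "R ^ ?n = g / ?k" by (simp_all add: R_def real_root_pow_pos2)
    have "h r z \<le> ennreal (?n * r ^ (?n - 1)) * indicator {0..R} r" for r :: real
    proof (cases "(r, z) \<in> \<Gamma>")
      case True
      then have r: "0 \<le> r" "\<And>a. r \<le> s a" "z \<in> ?M r" by (auto simp: \<Gamma>_def m)
      have "r ^ ?n * ?k \<le> g"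
        using measure_fiber_ge[OF K(1) r(3,1,2)] by (simp add: g_def S_def[abs_def])
      then have "r ^ ?n \<le> R ^ ?n" unfolding R(2) using K(2) by (simp add: pos_le_divide_eq)
      then have "r \<le> R" using R(1) n by (simp add: power_mono_iff r(1))
      with r show ?thesis by (simp add: h_def True)
    qed (simp add: h_def)
    then have "(\<integral>\<^sup>+r. h r z \<partial>lborel) \<le> (\<integral>\<^sup>+(r::real). ennreal (?n * r ^ (?n - 1)) * indicator {0..R} r \<partial>lborel)"
      by (intro nn_integral_mono)
    also have "\<dots> = ennreal (R ^ ?n - 0 ^ ?n)"
      using R(1) by (intro nn_integral_FTC_Icc) (auto intro!: derivative_eq_intros)
    also have "\<dots> = ennreal (g / ?k)"
      by (simp only: R zero_power[OF n] diff_zero)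
    also have "\<dots> = emeasure lborel (fiber S z) * ennreal (1 / ?k)"
      using K(2) by (simp add: fin g_def flip: ennreal_mult)
    finally show ?thesis .
  qed
  have row: "(\<integral>\<^sup>+z. h r z \<partial>lborel) = ennreal (?n * r ^ (?n - 1)) * indicator {0..m} r * ennreal (measure lebesgue (?M r))" for r :: real
  proof -
    have "(\<integral>\<^sup>+z. h r z \<partial>lborel) =
        (\<integral>\<^sup>+z. ennreal (?n * r ^ (?n - 1)) * indicator {0..m} r * indicator (?M r) z \<partial>lborel)"
      by (intro nn_integral_cong) (auto simp: h_def \<Gamma>_def indicator_def)
    also have "\<dots> = ennreal (?n * r ^ (?n - 1)) * indicator {0..m} r * emeasure lborel (?M r)"
      by (simp add: nn_integral_cmult)
    also have "emeasure lborel (?M r) = ennreal (measure lebesgue (?M r))"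
    proof -
      have "compact (?M r)" by (intro compact_minkowski bodies_convex_body K)
      then have "emeasure lebesgue (?M r) \<noteq> \<infinity>" using fmeasurableD2[OF lmeasurable_compact, of "?M r"] by simp
      then show ?thesis by (simp add: emeasure_eq_ennreal_measure)
    qed
    finally show ?thesis .
  qed
  have "(\<integral>\<^sup>+(r::real). ennreal (?n * r ^ (?n - 1)) * indicator {0..m} r * ennreal (measure lebesgue (?M r)) \<partial>lborel) =
      (\<integral>\<^sup>+z. (\<integral>\<^sup>+r. h r z \<partial>lborel) \<partial>lborel)"
    unfolding row[symmetric]
    by (rule pair_sigma_finite.Fubini'[OF pair_sigma_finite.intro meas, symmetric]) (rule sigma_finite_lborel)+
  also have "\<dots> \<le> (\<integral>\<^sup>+z. emeasure lborel (fiber S z) * ennreal (1 / ?k) \<partial>lborel)"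
    by (intro nn_integral_mono col)
  also have "\<dots> = (\<integral>\<^sup>+z. emeasure lborel (fiber S z) \<partial>lborel) * ennreal (1 / ?k)"
  proof (rule nn_integral_multc)
    have "{w \<in> space (borel \<Otimes>\<^sub>M borel). snd w \<in> S None \<and> (\<forall>i. snd w + fst w $ i \<in> S (Some i))}
        \<in> sets (borel \<Otimes>\<^sub>M borel)"
      by measurable
    then have "{w. snd w \<in> fiber S (fst w)} \<in> sets (lborel \<Otimes>\<^sub>M lborel)"
      by (simp add: fiber_def space_pair_measure)
    then have "(\<lambda>z. emeasure lborel (Pair z -` {w. snd w \<in> fiber S (fst w)})) \<in> borel_measurable lborel"
      by (rule sigma_finite_measure.measurable_emeasure_Pair[OF sigma_finite_lborel])
    then show "(\<lambda>z. emeasure lborel (fiber S z)) \<in> borel_measurable lborel"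
      by (simp add: vimage_def)
  qed
  also have "\<dots> = (\<Prod>a\<in>UNIV. ennreal (s a ^ ?n * ?k)) * ennreal (1 / ?k)"
    by (subst nn_integral_fiber) (simp_all add: emS)
  also have "\<dots> = ennreal ((\<Prod>a\<in>UNIV. s a ^ ?n * ?k) * (1 / ?k))"
    using s by (subst prod_ennreal) (auto simp: prod_nonneg simp flip: ennreal_mult)
  \<comment> \<open>The product carries p + 1 factors |K|, one of which cancels.\<close>
  also have "(\<Prod>a\<in>UNIV. s a ^ ?n * ?k) * (1 / ?k) = ?k ^ CARD('p) * (\<Prod>a\<in>UNIV. s a ^ ?n)"
    using K(2) by (simp add: prod.distrib card_UNIV_option)
  finally show ?thesis .
qed

text \<open>\<open>nn_integral_minkowski_le\<close> is integrated over the orthant against the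
  exponential with rates \<open>l a\<close>; with the monomial as lower bound for the volume, both
  sides become products of Gamma integrals. The rates stay free until the final choice.\<close>

lemma monomial_coefficient_bound:
  fixes K :: "(real^'n) set" and e :: "'p::finite option \<Rightarrow> nat" and l :: "'p option \<Rightarrow> real"
  assumes K: "convex_body K" "0 < measure lebesgue K" and l: "\<And>a. 0 < l a" and C: "0 \<le> C"
    and lower: "\<And>t. (\<And>a. 0 \<le> t a) \<Longrightarrow>
      C * (\<Prod>a\<in>UNIV. t a ^ e a) \<le> measure lebesgue (minkowski (bodies K :: _ \<Rightarrow> ((real^'n)^'p) set) t)"
  shows "C * (\<Prod>a\<in>UNIV. fact (e a) / l a ^ Suc (e a)) * (fact CARD('n) / (\<Sum>a\<in>UNIV. l a) ^ CARD('n))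
    \<le> measure lebesgue K ^ CARD('p) * (\<Prod>a\<in>UNIV. fact CARD('n) / l a ^ Suc CARD('n))"
proof -
  let ?n = "CARD('n)" and ?k = "measure lebesgue K" and ?L = "\<Sum>a\<in>UNIV. l a"
  have n: "Suc (?n - 1) = ?n" by simp
  \<comment> \<open>The cut-offs in \<open>u\<close>, \<open>f\<close> and \<open>g\<close> encode
    the ranges of integration, so for fixed \<open>r\<close> the integrand is a product over the
    parameters.\<close>
  define u where "u r = ennreal (?n * r ^ (?n - 1)) * indicator {0..} r" for r :: real
  define f where "f a r x = ennreal ((x - r) ^ e a * exp (- l a * x)) * indicator {r..} x" for a r x
  define g where "g a x = ennreal (x ^ ?n * exp (- l a * x)) * indicator {0..} x" for a x
  have f_meas: "(\<lambda>w. f a (fst w) (snd w)) \<in> borel_measurable borel" for a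
  proof -
    have "(\<lambda>w::real \<times> real. f a (fst w) (snd w)) =
        (\<lambda>w. ennreal ((snd w - fst w) ^ e a * exp (- l a * snd w)) * indicator {w. fst w \<le> snd w} w)"
      by (auto simp: f_def indicator_def)
    moreover have "{w :: real \<times> real. fst w \<le> snd w} \<in> sets borel"
      by (intro borel_closed closed_Collect_le continuous_intros)
    ultimately show ?thesis
      by (simp only:) (intro borel_measurable_times_ennreal borel_measurable_indicator
          measurable_compose[OF _ measurable_ennreal] borel_measurable_continuous_onI continuous_intros)
  qed
  have [measurable]: "u \<in> borel_measurable borel" "g a \<in> borel_measurable borel" "f a r \<in> borel_measurable borel" for a r
    unfolding u_def[abs_def] g_def[abs_def] f_def[abs_def] by measurable
  \<comment> \<open>The inequality for one parameter vector \<open>v\<close>; if some coordinate is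
    negative, both sides vanish.\<close>
  have pointwise: "(\<integral>\<^sup>+(r::real). u r * ennreal C * (\<Prod>a\<in>UNIV. f a r (v $ a)) \<partial>lborel) \<le>
      ennreal (?k ^ CARD('p)) * (\<Prod>a\<in>UNIV. g a (v $ a))" for v :: "real^'p option"
  proof (cases "\<forall>a. 0 \<le> v $ a")
    case False
    then obtain a where "v $ a < 0" by (auto simp: not_le)
    then have "u r = 0 \<or> (\<exists>a. f a r (v $ a) = 0)" for r
      by (auto simp: u_def f_def indicator_def intro!: exI[of _ a])
    then have zero: "u r * ennreal C * (\<Prod>a\<in>UNIV. f a r (v $ a)) = 0" for r
      by (auto simp: prod_zero_iff)
    show ?thesis by (simp only: zero nn_integral_const) simp
  next
    case True
    let ?s = "\<lambda>a. v $ a"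
    define E where "E = (\<Prod>a\<in>UNIV. exp (- l a * v $ a))"
    have E: "0 \<le> E" by (simp add: E_def prod_nonneg)
    define m where "m = Min (range ?s)"
    let ?V = "\<lambda>r. measure lebesgue (minkowski (bodies K :: _ \<Rightarrow> ((real^'n)^'p) set) (\<lambda>a. v $ a - r))"
    let ?q = "\<lambda>r. C * (\<Prod>a\<in>UNIV. (v $ a - r) ^ e a)"
    let ?w = "\<lambda>r::real. ennreal (?n * r ^ (?n - 1)) * indicator {0..m} r"
    have m: "r \<in> {0..m} \<longleftrightarrow> 0 \<le> r \<and> (\<forall>a. r \<le> v $ a)" for r by (simp add: m_def)
    have "u r * ennreal C * (\<Prod>a\<in>UNIV. f a r (v $ a)) = ennreal E * (?w r * ennreal (?q r))" for r
    proof (cases "r \<in> {0..m}")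
      case False
      then have "u r = 0 \<or> (\<exists>a. f a r (v $ a) = 0)"
      proof (cases "0 \<le> r")
        case True
        with False obtain a where "v $ a < r" unfolding m by (meson not_le)
        then have "f a r (v $ a) = 0" by (simp add: f_def)
        then show ?thesis by blast
      qed (simp add: u_def)
      then have "u r * ennreal C * (\<Prod>a\<in>UNIV. f a r (v $ a)) = 0"
        by (auto simp: prod_zero_iff)
      with False show ?thesis by simp
    next
      case r: True
      then have r': "0 \<le> r" "r \<le> v $ a" for a unfolding m by auto
      have "(\<Prod>a\<in>UNIV. f a r (v $ a)) = (\<Prod>a\<in>UNIV. ennreal ((v $ a - r) ^ e a * exp (- l a * v $ a)))"
        using r' by (simp add: f_def)
      also have "\<dots> = ennreal ((\<Prod>a\<in>UNIV. (v $ a - r) ^ e a) * E)"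
        using r' by (subst prod_ennreal) (auto simp: E_def prod.distrib)
      finally have eq: "u r * ennreal C * (\<Prod>a\<in>UNIV. f a r (v $ a)) =
          ennreal (?n * r ^ (?n - 1)) * (ennreal C * ennreal ((\<Prod>a\<in>UNIV. (v $ a - r) ^ e a) * E))"
        using r' by (simp add: u_def mult.assoc)
      have nn: "0 \<le> (\<Prod>a\<in>UNIV. (v $ a - r) ^ e a)" using r' by (auto intro!: prod_nonneg)
      have "ennreal C * ennreal ((\<Prod>a\<in>UNIV. (v $ a - r) ^ e a) * E) = ennreal E * ennreal (?q r)"
        using C nn E by (simp add: mult_ac flip: ennreal_mult)
      then show ?thesis unfolding eq using r by (simp add: mult_ac)
    qed
    then have "(\<integral>\<^sup>+r. u r * ennreal C * (\<Prod>a\<in>UNIV. f a r (v $ a)) \<partial>lborel) =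
        (\<integral>\<^sup>+r. ennreal E * (?w r * ennreal (?q r)) \<partial>lborel)"
      by simp
    also have "\<dots> = ennreal E * (\<integral>\<^sup>+r. ?w r * ennreal (?q r) \<partial>lborel)"
      by (rule nn_integral_cmult) measurable
    also have "\<dots> \<le> ennreal E * (\<integral>\<^sup>+r. ?w r * ennreal (?V r) \<partial>lborel)"
    proof (rule mult_left_mono[OF nn_integral_mono])
      show "?w r * ennreal (?q r) \<le> ?w r * ennreal (?V r)" for r
      proof (cases "r \<in> {0..m}")
        case True
        then have "r \<le> v $ a" for a unfolding m by auto
        then show ?thesis using lower[of "\<lambda>a. v $ a - r"] by (intro mult_left_mono ennreal_leI) auto
      qed simp
    qed simp
    also have "\<dots> \<le> ennreal E * ennreal (?k ^ CARD('p) * (\<Prod>a\<in>UNIV. v $ a ^ ?n))"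
      unfolding m_def using True by (intro mult_left_mono nn_integral_minkowski_le K) auto
    also have "\<dots> = ennreal (?k ^ CARD('p)) * (\<Prod>a\<in>UNIV. g a (v $ a))"
    proof -
      have "(\<Prod>a\<in>UNIV. g a (v $ a)) = (\<Prod>a\<in>UNIV. ennreal (v $ a ^ ?n * exp (- l a * v $ a)))"
        using True by (simp add: g_def)
      also have "\<dots> = ennreal ((\<Prod>a\<in>UNIV. v $ a ^ ?n) * E)"
        using True by (subst prod_ennreal) (auto simp: E_def prod.distrib)
      finally show ?thesis
        using E K True by (simp add: mult_ac prod_nonneg flip: ennreal_mult)
    qed
    finally show ?thesis .
  qed
  have L: "0 < ?L" by (intro sum_pos l) auto
  define c where "c = (\<Prod>a\<in>UNIV. fact (e a) / l a ^ Suc (e a))"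
  have c: "0 \<le> c" unfolding c_def using l by (auto intro!: prod_nonneg simp: less_imp_le)
  \<comment> \<open>With \<open>r\<close> outermost, the integral over \<open>v\<close> factors into
    shifted Gamma integrals whose exponentials combine to \<open>exp (- ?L * r)\<close>; the
    integral over \<open>r\<close> is again of Gamma type.\<close>
  have "(\<integral>\<^sup>+v. (\<integral>\<^sup>+r. u r * ennreal C * (\<Prod>a\<in>UNIV. f a r (v $ a)) \<partial>lborel) \<partial>lborel) =
      (\<integral>\<^sup>+r. (\<integral>\<^sup>+v. u r * ennreal C * (\<Prod>a\<in>UNIV. f a r (v $ a)) \<partial>lborel) \<partial>lborel)"
  proof (rule pair_sigma_finite.Fubini'[OF pair_sigma_finite.intro])
    have *: "(\<lambda>w. f a (fst w) (snd w $ a)) \<in> borel_measurable (lborel \<Otimes>\<^sub>M (lborel :: (real^'p option) measure))" for a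
    proof -
      have f': "(\<lambda>w. f a (fst w) (snd w)) \<in> borel_measurable (borel \<Otimes>\<^sub>M borel)"
        by (subst borel_prod) (rule f_meas)
      have "(\<lambda>w. (fst w, snd w $ a)) \<in> lborel \<Otimes>\<^sub>M (lborel :: (real^'p option) measure) \<rightarrow>\<^sub>M borel \<Otimes>\<^sub>M borel"
        by measurable
      from measurable_compose[OF this f'] show ?thesis by (simp only: fst_conv snd_conv)
    qed
    show "(\<lambda>(r, v :: real^'p option). u r * ennreal C * (\<Prod>a\<in>UNIV. f a r (v $ a))) \<in> borel_measurable (lborel \<Otimes>\<^sub>M lborel)"
      unfolding case_prod_beta by (intro borel_measurable_times_ennreal borel_measurable_prod_ennreal *) auto
  qed (rule sigma_finite_lborel)+
  also have "\<dots> = (\<integral>\<^sup>+r. u r * ennreal C * ennreal (c * exp (- ?L * r)) \<partial>lborel)"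
  proof (rule nn_integral_cong)
    fix r :: real
    have "(\<integral>\<^sup>+v. u r * ennreal C * (\<Prod>a\<in>UNIV. f a r (v $ a)) \<partial>lborel) =
        u r * ennreal C * (\<Prod>a\<in>UNIV. \<integral>\<^sup>+x. f a r x \<partial>lborel)"
      by (subst nn_integral_cmult) (simp_all add: nn_integral_vec_prod[where f = "\<lambda>a. f a r"])
    also have "(\<Prod>a\<in>UNIV. \<integral>\<^sup>+x. f a r x \<partial>lborel) =
        (\<Prod>a\<in>UNIV. ennreal (fact (e a) / l a ^ Suc (e a) * exp (- l a * r)))"
      unfolding f_def by (intro prod.cong refl nn_integral_power_exp_shift l)
    also have "\<dots> = ennreal (c * exp (- ?L * r))"
      using l by (subst prod_ennreal)
        (auto simp: c_def prod.distrib prod_dividef exp_sum sum_negf sum_distrib_right less_imp_le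
          simp flip: exp_sum)
    finally show "(\<integral>\<^sup>+v. u r * ennreal C * (\<Prod>a\<in>UNIV. f a r (v $ a)) \<partial>lborel) =
        u r * ennreal C * ennreal (c * exp (- ?L * r))" .
  qed
  also have "\<dots> = (\<integral>\<^sup>+r. ennreal (C * c * ?n) * (ennreal ((r - 0) ^ (?n - 1) * exp (- ?L * r)) * indicator {0..} r) \<partial>lborel)"
    using C c by (intro nn_integral_cong) (auto simp: u_def indicator_def mult_ac simp flip: ennreal_mult)
  also have "\<dots> = ennreal (C * c * ?n) * ennreal (fact (?n - 1) / ?L ^ Suc (?n - 1) * exp (- ?L * 0))"
    by (subst nn_integral_cmult) (simp_all only: nn_integral_power_exp_shift[OF L], measurable)
  also have "\<dots> = ennreal (C * c * (fact ?n / ?L ^ ?n))"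
  proof -
    \<comment> \<open>The constant n of the weight n r^(n-1) completes (n-1)! to n!.\<close>
    have "fact ?n = real ?n * fact (?n - 1)" by (simp add: fact_reduce)
    then show ?thesis using C c L by (simp add: mult_ac flip: ennreal_mult)
  qed
  finally have left: "(\<integral>\<^sup>+v. (\<integral>\<^sup>+r. u r * ennreal C * (\<Prod>a\<in>UNIV. f a r (v $ a)) \<partial>lborel) \<partial>lborel) =
    ennreal (C * c * (fact ?n / ?L ^ ?n))" .
  have "(\<integral>\<^sup>+v. ennreal (?k ^ CARD('p)) * (\<Prod>a\<in>UNIV. g a (v $ a)) \<partial>lborel) =
      ennreal (?k ^ CARD('p)) * (\<Prod>a\<in>UNIV. \<integral>\<^sup>+x. g a x \<partial>lborel)"
    by (subst nn_integral_cmult) (simp_all add: nn_integral_vec_prod[where f = g])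
  also have "(\<Prod>a\<in>UNIV. \<integral>\<^sup>+x. g a x \<partial>lborel) = (\<Prod>a\<in>UNIV. ennreal (fact ?n / l a ^ Suc ?n))"
    using nn_integral_power_exp_shift[OF l, where r = 0 and k = ?n] by (simp add: g_def)
  also have "\<dots> = ennreal (\<Prod>a\<in>UNIV. fact ?n / l a ^ Suc ?n)"
    using l by (intro prod_ennreal) (auto simp: less_imp_le)
  also have "ennreal (?k ^ CARD('p)) * \<dots> = ennreal (?k ^ CARD('p) * (\<Prod>a\<in>UNIV. fact ?n / l a ^ Suc ?n))"
    using l by (intro ennreal_mult[symmetric] prod_nonneg) (auto simp: less_imp_le)
  finally have "ennreal (C * c * (fact ?n / ?L ^ ?n)) \<le> ennreal (?k ^ CARD('p) * (\<Prod>a\<in>UNIV. fact ?n / l a ^ Suc ?n))"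
    unfolding left[symmetric] using nn_integral_mono[OF pointwise, of lborel "\<lambda>v. v"] by simp
  moreover have "0 \<le> ?k ^ CARD('p) * (\<Prod>a\<in>UNIV. fact ?n / l a ^ Suc ?n)"
    using l by (intro mult_nonneg_nonneg prod_nonneg) (auto simp: less_imp_le)
  ultimately show ?thesis by (simp add: c_def ennreal_le_iff)
qed

section \<open>Multiplicities of the bodies in W and the conclusion\<close>

lemma W_eq_mixed_volume_map:
  fixes K :: "(real^'n) set" and j :: "'p::{finite,linorder} option \<Rightarrow> nat"
  obtains bs where "W K j = mixed_volume (map (bodies K :: _ \<Rightarrow> (real^'n, 'p) vec set) bs)"
    and "\<And>a. count_list bs a = CARD('n) - j a"
proof
  let ?I = "sorted_list_of_set (UNIV :: 'p set)"
  let ?bs = "replicate (CARD('n) - j None) None @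
    concat (map (\<lambda>i. replicate (CARD('n) - j (Some i)) (Some i)) ?I)"
  show "W K j = mixed_volume (map (bodies K :: _ \<Rightarrow> (real^'n, 'p) vec set) ?bs)"
    by (simp add: W_def bodies_def map_concat o_def)
  have rep: "count_list (replicate m (x :: 'p option)) y = (if x = y then m else 0)" for m x y
    by (induction m) auto
  have cat: "count_list (concat (map (\<lambda>i. replicate (k i) (Some i)) is)) a =
      (case a of None \<Rightarrow> 0 | Some i \<Rightarrow> count_list is i * k i)" for "is" :: "'p list" and k a
    by (induction "is") (auto simp: rep count_list_append split: option.splits)
  have "distinct is \<Longrightarrow> count_list is i = (if i \<in> set is then 1 else 0)" for "is" and i :: 'p
    by (induction "is") auto
  then have "count_list ?I i = 1" for i :: 'p by simp
  then show "count_list ?bs a = CARD('n) - j a" for a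
    by (cases a) (simp_all add: rep cat count_list_append)
qed

theorem corollary9p2:
  fixes n p :: nat
    and j :: "'p::{finite,linorder} option \<Rightarrow> nat"
    and K :: "(real^'n) set"
  assumes "CARD('n) = n" and "CARD('p) = p"
    and "n \<ge> 2"
    and "j \<in> index_tuples n"
    and "\<And>a. 0 < j a \<and> j a < n"
    and "convex_body K"
  shows "W K j \<le> (fact n) ^ p / fact (n * p) * (real n ^ n / (\<Prod>a\<in>UNIV. real (j a) ^ j a))
                   * measure lebesgue K ^ p"
proof -
  let ?A = "bodies K :: 'p option \<Rightarrow> (real^'n, 'p) vec set" and ?k = "measure lebesgue K"
  define e where "e a = n - j a" for a
  have j: "0 < j a" "j a < n" for a using assms(5) by auto
  have sum_j: "(\<Sum>a\<in>UNIV. j a) = n" using assms(4) by (simp add: index_tuples_def)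
  obtain c :: "(('p \<times> 'n) indexed \<Rightarrow> 'p option) \<Rightarrow> real" where c: "\<And>\<psi>. 0 \<le> c \<psi>"
    "\<And>s. (\<And>a. 0 \<le> s a) \<Longrightarrow>
      measure lebesgue (minkowski ?A s) = (\<Sum>\<psi>\<in>UNIV. c \<psi> * (\<Prod>i\<in>UNIV. s (\<psi> i)))"
    by (rule measure_minkowski[of ?A, OF bodies_convex_body[OF assms(6)]]) blast
  obtain bs where bs: "W K j = mixed_volume (map ?A bs)" "\<And>a. count_list bs a = e a"
    unfolding e_def assms(1)[symmetric] by (rule W_eq_mixed_volume_map[of K j]) blast
  \<comment> \<open>The multiplicities \<open>n - j a\<close> add up to (p + 1)n - n = np, the
    dimension.\<close>
  have len: "length bs = n * p"
  proof -
    have "length bs = (\<Sum>a\<in>UNIV. count_list bs a)"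
      by (rule sum_count_set[symmetric]) auto
    also have "\<dots> = (\<Sum>a\<in>(UNIV :: 'p option set). n) - (\<Sum>a\<in>UNIV. j a)"
      unfolding bs e_def by (rule sum_subtractf_nat) (simp add: j less_imp_le)
    finally show ?thesis by (simp add: sum_j card_UNIV_option assms(2) algebra_simps)
  qed
  \<comment> \<open>These maps contribute to the monomial with exponents \<open>e a\<close>, and
    \<open>C\<close> is its total coefficient in the volume polynomial.\<close>
  define \<Psi> where "\<Psi> = {\<psi> :: ('p \<times> 'n) indexed \<Rightarrow> 'p option. \<forall>a. card {i. \<psi> i = a} = e a}"
  define C where "C = sum c \<Psi>"
  have C: "0 \<le> C" unfolding C_def by (intro sum_nonneg c)
  have W: "W K j = (\<Prod>a\<in>UNIV. fact (e a)) / fact (n * p) * C"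
    unfolding bs(1) using mixed_volume_map[of ?A, OF bodies_convex_body(2,3)[OF assms(6)] c(2), of bs]
    by (simp add: bs(2) len C_def \<Psi>_def)
  show ?thesis
  proof (cases "?k = 0")
    \<comment> \<open>A null convex body lies in a hyperplane, hence so does the combination with
      all parameters 1. Its volume is the sum of the nonnegative coefficients, so all of them vanish
      and W is 0.\<close>
    case True
    have "interior K = {}"
    proof (rule ccontr)
      assume "interior K \<noteq> {}"
      then have "\<not> negligible K" using open_not_negligible[of "interior K"] interior_subset negligible_subset by blast
      moreover have "K \<in> lmeasurable" using assms(6) by (simp add: convex_body_def lmeasurable_compact)
      ultimately show False using True negligible_iff_measure by blast
    qed
    then obtain w b where w: "w \<noteq> 0" "K \<subseteq> {x. w \<bullet> x = b}"
      using empty_interior_subset_hyperplane[of K] assms(6) by (auto simp: convex_body_def)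
    \<comment> \<open>Any of the p factors serves.\<close>
    define i0 :: 'p where "i0 = undefined"
    have "minkowski ?A (\<lambda>_. 1) \<subseteq> {z. axis i0 w \<bullet> z = 0}"
    proof
      fix z assume "z \<in> minkowski ?A (\<lambda>_. 1)"
      then obtain y x where "y \<in> K" "\<And>i. x i \<in> K" "\<And>i. z $ i = 1 *\<^sub>R x i - 1 *\<^sub>R y"
        by (rule minkowski_bodiesE) blast
      then have "w \<bullet> z $ i0 = b - b" using w(2) by (auto simp: inner_diff_right)
      then show "z \<in> {z. axis i0 w \<bullet> z = 0}" by (simp add: inner_axis')
    qed
    moreover have "axis i0 w \<noteq> 0" using w(1) by (simp add: axis_eq_0_iff)
    ultimately have "measure lebesgue (minkowski ?A (\<lambda>_. 1)) = 0"
      by (intro negligible_imp_measure0 negligible_subset[OF negligible_hyperplane[of "axis i0 w" 0]]) auto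
    then have "(\<Sum>\<psi>\<in>UNIV. c \<psi>) = 0" using c(2)[of "\<lambda>_. 1"] by simp
    then have "c \<psi> = 0" for \<psi> using c(1) by (simp add: sum_nonneg_eq_0_iff)
    then have "W K j = 0" by (simp add: W C_def)
    then show ?thesis by (auto intro!: mult_nonneg_nonneg divide_nonneg_nonneg prod_nonneg)
  next
    case False
    then have k: "0 < ?k" by (simp add: less_le)
    \<comment> \<open>Discarding the other nonnegative terms leaves the maps in \<Psi>, all of which
      yield the same monomial.\<close>
    have lower: "C * (\<Prod>a\<in>UNIV. t a ^ e a) \<le> measure lebesgue (minkowski ?A t)" if t: "\<And>a. 0 \<le> t a" for t
    proof -
      have mono: "(\<Prod>i\<in>UNIV. t (\<psi> i)) = (\<Prod>a\<in>UNIV. t a ^ e a)" if "\<psi> \<in> \<Psi>" for \<psi>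
      proof -
        have "(\<Prod>i\<in>UNIV. t (\<psi> i)) = (\<Prod>a\<in>UNIV. \<Prod>i\<in>{i\<in>UNIV. \<psi> i = a}. t (\<psi> i))"
          by (rule prod.group[symmetric]) auto
        then show ?thesis using that by (simp add: \<Psi>_def)
      qed
      have "C * (\<Prod>a\<in>UNIV. t a ^ e a) = (\<Sum>\<psi>\<in>\<Psi>. c \<psi> * (\<Prod>i\<in>UNIV. t (\<psi> i)))"
        by (simp add: C_def sum_distrib_right mono)
      also have "\<dots> \<le> (\<Sum>\<psi>\<in>UNIV. c \<psi> * (\<Prod>i\<in>UNIV. t (\<psi> i)))"
        using c(1) t by (intro sum_mono2) (auto intro!: mult_nonneg_nonneg prod_nonneg)
      finally show ?thesis using c(2)[OF t] by simp
    qed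
    \<comment> \<open>Common to both sides of the bound: j^(n+1) splits as j^(n-j+1) times j^j, so
      only the powers j^j survive the cancellation.\<close>
    define J where "J a = real (j a) ^ Suc (e a)" for a
    have J: "0 < (\<Prod>a\<in>UNIV. J a)" using j by (intro prod_pos) (simp add: J_def)
    have pow: "real (j a) ^ Suc n = J a * real (j a) ^ j a" for a
      using j[of a] by (simp add: J_def e_def flip: power_add)
    \<comment> \<open>The rates are taken to be \<open>j a\<close>; their sum is \<open>n\<close>,
      which produces the factor n^n.\<close>
    have "C * (\<Prod>a\<in>UNIV. fact (e a) / J a) * (fact n / real n ^ n)
        \<le> ?k ^ p * (\<Prod>a\<in>UNIV. fact n / (J a * real (j a) ^ j a))"
      using monomial_coefficient_bound[OF assms(6) k _ C lower, of "\<lambda>a. real (j a)"] j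
      unfolding pow[symmetric] unfolding J_def by (simp add: assms(1,2) sum_j flip: of_nat_sum)
    then have ineq: "C * (\<Prod>a\<in>UNIV. fact (e a)) / (\<Prod>a\<in>UNIV. J a) * (fact n / real n ^ n)
        \<le> ?k ^ p * (fact n * fact n ^ p / ((\<Prod>a\<in>UNIV. J a) * (\<Prod>a\<in>UNIV. real (j a) ^ j a)))"
      by (simp add: prod_dividef prod.distrib card_UNIV_option assms(2))
    \<comment> \<open>Both sides are multiplied by \<open>P * N / G\<close>; here \<open>P\<close>
      is the product of the \<open>J a\<close>, \<open>G\<close> is n! and \<open>N\<close> is
      n^n.\<close>
    have cancel: "X \<le> Y * (F * (N / Q))" if "X / P * (G / N) \<le> Y * (G * F / (P * Q))" "0 < P" "0 < G" "0 < N"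
      for X Y F G N P Q :: real
      using mult_right_mono[OF that(1), of "P * N / G"] that by simp
    have "C * (\<Prod>a\<in>UNIV. fact (e a)) \<le> ?k ^ p * (fact n ^ p * (real n ^ n / (\<Prod>a\<in>UNIV. real (j a) ^ j a)))"
      using assms(3) by (intro cancel[OF ineq J]) auto
    then have "C * (\<Prod>a\<in>UNIV. fact (e a)) / fact (n * p) \<le>
        ?k ^ p * (fact n ^ p * (real n ^ n / (\<Prod>a\<in>UNIV. real (j a) ^ j a))) / fact (n * p)"
      by (rule divide_right_mono) simp
    then show ?thesis unfolding W by (simp add: mult_ac)
  qed
qed

end
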